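(* Let $\alpha_1$ and $\alpha_2$ be distinct real numbers, each having an infinite ordinary continued fraction with bounded elements (partial quotients). Let $\mathcal A$ be the MCRS-group in $GL(2,\mathbb R)$ with eigenspaces $y=\alpha_1 x$ and $y=\alpha_2 x$. Then there exist positive constants $C_1$ and $C_2$ such that for every positive integer $N$ the best approximation $\mathcal A_N$ of $\mathcal A$ of size not exceeding $N$ in $\mathrm{Rat}_2$ satisfies $$\frac{C_1}{N^2}<\rho(\mathcal A,\mathcal A_N)<\frac{C_2}{N^2}.$$
   Context: Let $I^2=-1$. A real operator on $\mathbb R^2$ (with a fixed basis, coordinates $(x,y)$) is regular if its eigenvalues are distinct (not necessarily real). An MCRS-group is a maximal commutative subgroup of $GL(2,\mathbb R)$ containing a regular operator. Its eigenspaces are the two distinct one-dimensional complex subspaces $l_1,l_2$ of $\mathbb C^2$ that are eigenspaces of any of its regular operators; they determine the group. Markoff-Davenport form: let $L_i$ be a nonzero linear form on $\mathbb C^2$ vanishing on $l_j$, $j\neq i$. Put $\Phi_{\mathcal A}(x,y)=L_1(x,y)L_2(x,y)/\Delta(L_1,L_2)$, where $\Delta(L_1,L_2)$ is the determinant of the matrix whose $k$-th column consists of the coefficients of $L_k$. It is determined by $\mathcal A$ up to sign. Discrepancy: for MCRS-groups $\mathcal A_1,\mathcal A_2$, take the maximal absolute value (complex modulus) of the coefficients of the quadratic form $\Phi_{\mathcal A_1}+\Phi_{\mathcal A_2}$, and likewise of $\Phi_{\mathcal A_1}-\Phi_{\mathcal A_2}$; $\rho(\mathcal A_1,\mathcal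 A_2)$ is the smaller of these two numbers. Rational groups and size: a Gaussian vector is a vector with coordinates in $\mathbb Z[I]$; it is primitive if its coordinates are relatively prime. An MCRS-group is rational if both its eigenspaces contain nonzero Gaussian vectors; $\mathrm{Rat}_2$ is the set of all rational MCRS-groups in $GL(2,\mathbb R)$. For $v=(v_1,v_2)\in\mathbb C^2$ put $|v|=\max(|v_1|,|v_2|)$. The size $\nu(\mathcal A)$ of a rational MCRS-group is $\max(|v_1|,|v_2|)$, where $v_i$ is a primitive Gaussian vector in the eigenspace $l_i$. Best approximation: for a positive integer $N$, $\mathcal A_N$ denotes a group in $\mathrm{Rat}_2$ with $\nu(\mathcal A_N)\le N$ and $\rho(\mathcal A,\mathcal A_N)=\min\{\rho(\mathcal A,\mathcal A'):\mathcal A'\in\mathrm{Rat}_2,\ \nu(\mathcal A')\le N\}$. *)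

theory Defs
  imports "HOL-Analysis.Analysis" "HOL-Algebra.Group"
begin

section \<open>Maximal commutative subgroups with a regular element\<close>

definition complexify :: "real^2^2 \<Rightarrow> complex^2^2" where
  "complexify A = map_matrix complex_of_real A"

definition eigval :: "real^2^2 \<Rightarrow> complex \<Rightarrow> bool" where
  "eigval A c \<longleftrightarrow> (\<exists>v. v \<noteq> 0 \<and> complexify A *v v = c *s v)"

definition eigenspace :: "real^2^2 \<Rightarrow> complex \<Rightarrow> (complex^2) set" where
  "eigenspace A c = {v. complexify A *v v = c *s v}"

definition regular :: "real^2^2 \<Rightarrow> bool" where
  "regular A \<longleftrightarrow> (\<exists>c d. c \<noteq> d \<and> eigval A c \<and> eigval A d)"

definition GL2 :: "(real^2^2) monoid" where
  "GL2 = \<lparr>carrier = {A. invertible A}, mult = (**), one = mat 1\<rparr>"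

definition comm_subgroup :: "(real^2^2) set \<Rightarrow> bool" where
  "comm_subgroup H \<longleftrightarrow> subgroup H GL2 \<and> comm_group (GL2\<lparr>carrier := H\<rparr>)"

definition mcrs_group :: "(real^2^2) set \<Rightarrow> bool" where
  "mcrs_group H \<longleftrightarrow> comm_subgroup H \<and>
     (\<forall>K. comm_subgroup K \<and> H \<subseteq> K \<longrightarrow> K = H) \<and> (\<exists>A\<in>H. regular A)"

text \<open>The regular operators of an MCRS-group share the same pair of eigenspaces; this is the
  set of those two lines.\<close>

definition eigenspaces :: "(real^2^2) set \<Rightarrow> (complex^2) set set" where
  "eigenspaces H = {l. \<forall>A\<in>H. regular A \<longrightarrow> (\<exists>c. eigval A c \<and> l = eigenspace A c)}"

text \<open>The complex line \<open>y = a x\<close>.\<close>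

definition slope_line :: "real \<Rightarrow> (complex^2) set" where
  "slope_line a = {v. v $ 2 = complex_of_real a * v $ 1}"


section \<open>Markoff-Davenport forms and the discrepancy\<close>

text \<open>Linear and quadratic forms are represented by their coefficient vectors:
  \<open>L\<close> stands for $L_1 x + L_2 y$ and \<open>q\<close> for $q_1 x^2 + q_2 x y + q_3 y^2$.\<close>

definition lin_form :: "complex^2 \<Rightarrow> complex^2 \<Rightarrow> complex" where
  "lin_form L v = L $ 1 * v $ 1 + L $ 2 * v $ 2"

definition quad_form :: "complex^3 \<Rightarrow> complex^2 \<Rightarrow> complex" where
  "quad_form q v = q $ 1 * (v $ 1)^2 + q $ 2 * (v $ 1 * v $ 2) + q $ 3 * (v $ 2)^2"

definition form_det :: "complex^2 \<Rightarrow> complex^2 \<Rightarrow> complex" where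
  "form_det L1 L2 = det (\<chi> i k. if k = 1 then L1 $ i else L2 $ i)"

definition is_md_form :: "(real^2^2) set \<Rightarrow> complex^3 \<Rightarrow> bool" where
  "is_md_form H q \<longleftrightarrow> (\<exists>l1 l2 L1 L2. eigenspaces H = {l1, l2} \<and> l1 \<noteq> l2 \<and>
     L1 \<noteq> 0 \<and> (\<forall>v\<in>l2. lin_form L1 v = 0) \<and>
     L2 \<noteq> 0 \<and> (\<forall>v\<in>l1. lin_form L2 v = 0) \<and>
     (\<forall>v. quad_form q v = lin_form L1 v * lin_form L2 v / form_det L1 L2))"

text \<open>The form is determined only up to sign; the discrepancy below does not depend on the
  choice.\<close>

definition md_form :: "(real^2^2) set \<Rightarrow> complex^3" where
  "md_form H = (SOME q. is_md_form H q)"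

definition max_coeff :: "complex^3 \<Rightarrow> real" where
  "max_coeff q = Max (range (\<lambda>i. cmod (q $ i)))"

definition discrepancy :: "(real^2^2) set \<Rightarrow> (real^2^2) set \<Rightarrow> real" where
  "discrepancy H K = min (max_coeff (md_form H + md_form K)) (max_coeff (md_form H - md_form K))"


section \<open>Rational groups, size and best approximations\<close>

definition gauss_ints :: "complex set" where
  "gauss_ints = {z. Re z \<in> \<int> \<and> Im z \<in> \<int>}"

definition gauss_vec :: "complex^2 \<Rightarrow> bool" where
  "gauss_vec v \<longleftrightarrow> (\<forall>i. v $ i \<in> gauss_ints)"

text \<open>Relatively prime in the ring of Gaussian integers: every common divisor is a unit.\<close>

definition primitive_vec :: "complex^2 \<Rightarrow> bool" where
  "primitive_vec v \<longleftrightarrow> gauss_vec v \<and>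
     (\<forall>d\<in>gauss_ints. (\<forall>i. \<exists>e\<in>gauss_ints. v $ i = d * e) \<longrightarrow> (\<exists>u\<in>gauss_ints. d * u = 1))"

definition rational_group :: "(real^2^2) set \<Rightarrow> bool" where
  "rational_group H \<longleftrightarrow> mcrs_group H \<and> (\<forall>l\<in>eigenspaces H. \<exists>v\<in>l. v \<noteq> 0 \<and> gauss_vec v)"

definition Rat2 :: "(real^2^2) set set" where
  "Rat2 = {H. rational_group H}"

definition max_abs :: "complex^2 \<Rightarrow> real" where
  "max_abs v = max (cmod (v $ 1)) (cmod (v $ 2))"

text \<open>A primitive vector on a line is unique up to a unit of modulus one, so the size does not
  depend on the choice made here.\<close>

definition line_size :: "(complex^2) set \<Rightarrow> real" where
  "line_size l = max_abs (SOME v. v \<in> l \<and> primitive_vec v)"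

definition size_mcrs :: "(real^2^2) set \<Rightarrow> real" where
  "size_mcrs H = Max (line_size ` eigenspaces H)"

definition best_approx :: "(real^2^2) set \<Rightarrow> nat \<Rightarrow> (real^2^2) set \<Rightarrow> bool" where
  "best_approx H N B \<longleftrightarrow> is_arg_min (discrepancy H) (\<lambda>K. K \<in> Rat2 \<and> size_mcrs K \<le> real N) B"


section \<open>Ordinary continued fractions\<close>

text \<open>\<open>cf_value a n\<close> is the finite continued fraction \<open>[a 0; a 1, \<dots>, a n]\<close>.\<close>

fun cf_value :: "(nat \<Rightarrow> int) \<Rightarrow> nat \<Rightarrow> real" where
  "cf_value a 0 = of_int (a 0)"
| "cf_value a (Suc n) = of_int (a 0) + 1 / cf_value (\<lambda>k. a (Suc k)) n"

definition has_inf_cf :: "real \<Rightarrow> (nat \<Rightarrow> int) \<Rightarrow> bool" where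
  "has_inf_cf \<alpha> a \<longleftrightarrow> (\<forall>k\<ge>1. a k \<ge> 1) \<and> cf_value a \<longlonglongrightarrow> \<alpha>"

definition bounded_inf_cf :: "real \<Rightarrow> bool" where
  "bounded_inf_cf \<alpha> \<longleftrightarrow> (\<exists>a. has_inf_cf \<alpha> a \<and> (\<exists>M. \<forall>k. \<bar>a k\<bar> \<le> M))"

end

theory Submission
  imports Defs
begin

text \<open>
  Let \<open>q\<close> be the Markoff-Davenport form of the given group, which up to sign is
  \<open>(y - \<alpha>1 x) (y - \<alpha>2 x) / (\<alpha>1 - \<alpha>2)\<close>.

  The lower bound comes from evaluating forms at Gaussian points.  Let \<open>K\<close> be a rational group of
  size at most \<open>N\<close> and \<open>v\<close> a primitive vector in one of its eigenspaces.  The form of \<open>K\<close> vanishes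
  at \<open>v\<close>, so \<open>q v\<close> is the value at \<open>v\<close> of the sum as well as of the difference of the two forms,
  and its modulus is at most \<open>3 N\<^sup>2\<close> times the discrepancy.  On the other hand \<open>q\<close> is bounded away from \<open>0\<close>
  on all nonzero Gaussian vectors (\<open>badly_approximable_form_lower_bound\<close>): since the partial
  quotients are bounded, each factor \<open>y - \<alpha>\<^sub>i x\<close> is at least a constant over the length of the
  vector, and since \<open>\<alpha>1 \<noteq> \<alpha>2\<close>, the larger factor is comparable to that length.  Real and complex
  eigenspaces are treated alike, because \<open>\<alpha>\<^sub>i\<close> is real and one can pass to the real or the
  imaginary part of the vector.

  For the upper bound it suffices to exhibit one rational group.  Dirichlet's theorem gives fractions
  \<open>p\<^sub>i/q\<^sub>i\<close> close to \<open>\<alpha>\<^sub>i\<close> with numerators and denominators at most \<open>N\<close>.  Bad approximability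
  prevents the denominators from being much smaller than \<open>N\<close>, so the error is at most a constant over
  \<open>N\<^sup>2\<close> (\<open>badly_approximable_quadratic_approx\<close>).  The lines \<open>y = (p\<^sub>i/q\<^sub>i) x\<close> are the eigenspaces of
  the centralizer of a regular operator, which is an MCRS-group, and the coefficients of the form are
  locally Lipschitz in the slopes (\<open>slope_form_locally_lipschitz\<close>).

  A best approximation exists because the discrepancy depends only on the eigenspaces, and only
  finitely many lines are spanned by Gaussian vectors of length at most \<open>N\<close>
  (\<open>finite_discrepancy_image\<close>).

  That bounded partial quotients make a number badly approximable is proved without convergents, by a
  descent on indefinite binary forms (\<open>cf_form_lower_bound\<close>).
\<close>

section \<open>Continued fractions with bounded elements\<close>

text \<open>
  Every tail of a continued fraction has value in \<open>[1, a 0 + 1]\<close>; this keeps the limits of the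
  tails away from \<open>0\<close> and \<open>\<infinity>\<close>.
\<close>
lemma cf_value_bounds:
  assumes "\<And>k. a k \<ge> 1"
  shows "1 \<le> cf_value a n \<and> cf_value a n \<le> of_int (a 0) + 1"
  using assms
proof (induction n arbitrary: a)
  case 0
  then show ?case by simp
next
  case (Suc n)
  have "1 \<le> cf_value (\<lambda>k. a (Suc k)) n"
    using Suc.IH[of "\<lambda>k. a (Suc k)"] Suc.prems by simp
  then have "0 \<le> 1 / cf_value (\<lambda>k. a (Suc k)) n" "1 / cf_value (\<lambda>k. a (Suc k)) n \<le> 1"
    by (auto simp: divide_le_eq)
  moreover have "1 \<le> real_of_int (a 0)" using Suc.prems[of 0] by simp
  ultimately show ?case unfolding cf_value.simps by linarith
qed

text \<open>
  The complete quotient \<open>\<alpha>'\<close> is the limit of the values of the tails.  That limit exists because the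
  tail values are the reciprocals of \<open>cf_value a (Suc n) - a 0\<close>, a sequence bounded away from \<open>0\<close>.
\<close>
lemma has_inf_cf_tail:
  assumes "has_inf_cf \<alpha> a"
  obtains \<alpha>' where "has_inf_cf \<alpha>' (\<lambda>k. a (Suc k))" "1 \<le> \<alpha>'" "\<alpha>' \<le> of_int (a 1) + 1"
    "\<alpha> = of_int (a 0) + 1 / \<alpha>'"
proof -
  define b where "b = (\<lambda>k. a (Suc k))"
  have b: "b k \<ge> 1" for k using assms by (simp add: has_inf_cf_def b_def)
  note bnd = cf_value_bounds[of b, OF b]
  have "(\<lambda>n. cf_value a (Suc n)) \<longlonglongrightarrow> \<alpha>"
    using assms unfolding has_inf_cf_def by (simp add: LIMSEQ_Suc del: cf_value.simps)
  then have "(\<lambda>n. of_int (a 0) + 1 / cf_value b n) \<longlonglongrightarrow> \<alpha>"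
    by (simp add: b_def)
  from tendsto_diff[OF this tendsto_const[of "of_int (a 0)"]]
  have lim: "(\<lambda>n. 1 / cf_value b n) \<longlonglongrightarrow> \<alpha> - of_int (a 0)" by simp
  have "1 / (of_int (b 0) + 1) \<le> 1 / cf_value b n" for n
    using bnd[of n] by (intro divide_left_mono) auto
  then have "1 / (of_int (b 0) + 1) \<le> \<alpha> - of_int (a 0)"
    by (intro tendsto_lowerbound[OF lim]) auto
  moreover have "0 < 1 / (real_of_int (b 0) + 1)" using b[of 0] by simp
  ultimately have pos: "0 < \<alpha> - of_int (a 0)" by linarith
  have lim': "cf_value b \<longlonglongrightarrow> 1 / (\<alpha> - of_int (a 0))"
    using tendsto_divide[OF tendsto_const[of 1] lim] pos by simp
  show thesis
  proof
    show "has_inf_cf (1 / (\<alpha> - of_int (a 0))) (\<lambda>k. a (Suc k))"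
      using lim' b by (simp add: has_inf_cf_def b_def)
    show "1 \<le> 1 / (\<alpha> - of_int (a 0))"
      using bnd by (intro tendsto_lowerbound[OF lim']) auto
    show "1 / (\<alpha> - of_int (a 0)) \<le> of_int (a 1) + 1"
      using bnd by (intro tendsto_upperbound[OF lim']) (auto simp: b_def)
    show "\<alpha> = of_int (a 0) + 1 / (1 / (\<alpha> - of_int (a 0)))" by simp
  qed
qed

text \<open>
  The quantity on the right is the absolute value of the binary form with roots \<open>\<alpha>\<close> and \<open>- \<gamma>\<close>,
  divided by the square root of its discriminant.  Passing from \<open>\<alpha> = a 0 + 1/\<beta>\<close> to \<open>\<beta>\<close>, from \<open>\<gamma>\<close> to
  \<open>\<delta> = 1 / (a 0 + \<gamma>)\<close> and from \<open>(p, q)\<close> to \<open>(q, p - a 0 * q)\<close> is a unimodular change of variables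
  which leaves it unchanged.  As \<open>p + q\<close> drops, this process ends, and it ends with
  \<open>p \<le> a 0 * q\<close>, where the factor \<open>p - \<alpha> q\<close> is visibly not small.  Carrying the second root
  \<open>- \<gamma>\<close> along is what makes the quantity exactly invariant: \<open>q * \<bar>p - \<alpha> q\<bar>\<close> alone
  changes at each step.
\<close>
lemma cf_form_lower_bound:
  fixes p q :: int and \<gamma> :: real
  assumes "has_inf_cf \<alpha> a" "\<And>k. 1 \<le> a k" "\<And>k. a k \<le> M" "0 \<le> \<gamma>" "\<gamma> \<le> 1" "1 \<le> p" "1 \<le> q"
  shows "1 / ((of_int M + 1) * (of_int M + 2))
    \<le> \<bar>of_int p - \<alpha> * of_int q\<bar> * (of_int p + \<gamma> * of_int q) / (\<alpha> + \<gamma>)"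
  using assms
proof (induction "nat (p + q)" arbitrary: p q \<alpha> \<gamma> a rule: less_induct)
  case less
  obtain \<beta> where \<beta>: "has_inf_cf \<beta> (\<lambda>k. a (Suc k))" "1 \<le> \<beta>" "\<beta> \<le> of_int (a 1) + 1"
    "\<alpha> = of_int (a 0) + 1 / \<beta>"
    using has_inf_cf_tail[OF less.prems(1)] by blast
  have a0: "1 \<le> real_of_int (a 0)" "real_of_int (a 0) \<le> of_int M" and "\<beta> \<le> of_int M + 1"
    using less.prems(2,3)[of 0] \<beta>(3) less.prems(3)[of 1] by auto
  have \<beta>inv: "1 / (of_int M + 1) \<le> 1 / \<beta>" "1 / \<beta> \<le> 1"
    using \<open>\<beta> \<le> of_int M + 1\<close> \<beta>(2) by (auto intro: divide_left_mono)
  have "0 < 1 / \<beta>" using \<beta>(2) by simp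
  define r where "r = p - a 0 * q"
  \<comment> \<open>In the final case \<open>\<bar>p - \<alpha> q\<bar> \<ge> q / \<beta>\<close>; otherwise one step of the descent applies.\<close>
  show ?case
  proof (cases "r \<le> 0")
    case True
    have q: "1 \<le> real_of_int q" and p: "1 \<le> real_of_int p" using less.prems by auto
    have "real_of_int r \<le> 0" using True by simp
    then have "real_of_int p \<le> of_int (a 0) * of_int q" by (simp add: r_def)
    moreover have "\<alpha> * of_int q = of_int (a 0) * of_int q + 1 / \<beta> * of_int q"
      by (simp add: \<beta>(4) algebra_simps)
    moreover have "1 / (of_int M + 1) * 1 \<le> 1 / \<beta> * real_of_int q"
      using \<beta>inv \<beta>(2) q a0 by (intro mult_mono) auto
    ultimately have 1: "1 / (of_int M + 1) \<le> \<bar>of_int p - \<alpha> * of_int q\<bar>" by linarith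
    have "0 \<le> \<gamma> * of_int q" using less.prems q by simp
    then have "1 \<le> of_int p + \<gamma> * of_int q" using p by linarith
    with 1 have 2: "1 / (of_int M + 1) * 1 \<le> \<bar>of_int p - \<alpha> * of_int q\<bar> * (of_int p + \<gamma> * of_int q)"
      using a0 by (intro mult_mono) auto
    have 3: "\<alpha> + \<gamma> \<le> of_int M + 2" "0 < \<alpha> + \<gamma>"
      using \<beta>(4) \<beta>inv a0 less.prems(4,5) \<open>0 < 1 / \<beta>\<close> by linarith+
    have "1 / (of_int M + 1) * 1 / (of_int M + 2)
        \<le> \<bar>of_int p - \<alpha> * of_int q\<bar> * (of_int p + \<gamma> * of_int q) / (\<alpha> + \<gamma>)"
      using 2 3 \<open>1 \<le> of_int p + \<gamma> * of_int q\<close> by (intro frac_le mult_nonneg_nonneg) auto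
    then show ?thesis by simp
  next
    case False
    then have r: "1 \<le> r" by simp
    define \<delta> where "\<delta> = 1 / (of_int (a 0) + \<gamma>)"
    have \<delta>: "0 \<le> \<delta>" "\<delta> \<le> 1"
      unfolding \<delta>_def using a0 less.prems(4) by (simp_all add: divide_le_eq)
    have "a 0 * q \<ge> 1 * q" using less.prems(2)[of 0] less.prems(7) by (intro mult_right_mono) auto
    then have "nat (q + r) < nat (p + q)" using less.prems(6,7) r unfolding r_def by linarith
    note IH = less.hyps[OF this \<beta>(1) less.prems(2,3) \<delta> less.prems(7) r]
    have pos: "0 < of_int (a 0) + \<gamma>" "0 < \<beta>" using a0 less.prems(4) \<beta>(2) by linarith+
    have p: "real_of_int p = of_int r + of_int (a 0) * of_int q" by (simp add: r_def)
    have "of_int p - \<alpha> * of_int q = - ((of_int q - \<beta> * of_int r) / \<beta>)"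
      unfolding p \<beta>(4) using pos(2) by (simp add: diff_divide_distrib distrib_right)
    then have e1: "\<bar>of_int p - \<alpha> * of_int q\<bar> = \<bar>of_int q - \<beta> * of_int r\<bar> / \<beta>"
      using pos(2) by (simp add: abs_divide)
    have inv\<delta>: "1 / \<delta> = of_int (a 0) + \<gamma>" "\<delta> \<noteq> 0" using pos(1) by (simp_all add: \<delta>_def)
    have "(of_int q + \<delta> * of_int r) / \<delta> = of_int q * (1 / \<delta>) + of_int r"
      using inv\<delta>(2) by (simp add: add_divide_distrib)
    then have e2: "of_int p + \<gamma> * of_int q = (of_int q + \<delta> * of_int r) / \<delta>"
      unfolding inv\<delta>(1) p by (simp add: algebra_simps)
    have "(\<beta> + \<delta>) / (\<beta> * \<delta>) = 1 / \<delta> + 1 / \<beta>"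
      using inv\<delta>(2) pos(2) by (simp add: add_divide_distrib)
    then have e3: "\<alpha> + \<gamma> = (\<beta> + \<delta>) / (\<beta> * \<delta>)"
      unfolding inv\<delta>(1) by (simp add: \<beta>(4))
    have "\<delta> > 0" using pos by (simp add: \<delta>_def)
    then have "\<bar>of_int p - \<alpha> * of_int q\<bar> * (of_int p + \<gamma> * of_int q) / (\<alpha> + \<gamma>)
      = \<bar>of_int q - \<beta> * of_int r\<bar> * (of_int q + \<delta> * of_int r) / (\<beta> + \<delta>)"
      using pos unfolding e1 e2 e3 by simp
    with IH show ?thesis by simp
  qed
qed

text \<open>
  The homogeneous version of the usual condition \<open>q * \<bar>q \<alpha> - p\<bar> \<ge> c\<close>: with the maximum in place of
  \<open>\<bar>q\<bar>\<close> it makes sense for every nonzero integer vector, also when \<open>q = 0\<close>.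
\<close>
definition badly_approximable :: "real \<Rightarrow> bool" where
  "badly_approximable \<alpha> \<longleftrightarrow> (\<exists>c>0. \<forall>p q :: int. (p, q) \<noteq> (0, 0) \<longrightarrow>
     c \<le> \<bar>of_int p - \<alpha> * of_int q\<bar> * of_int (max \<bar>p\<bar> \<bar>q\<bar>))"

text \<open>
  The integral shear \<open>(p, q) \<mapsto> (p - k q, q)\<close> changes the maximum by a factor of at most \<open>1 + \<bar>k\<bar>\<close>.
\<close>
lemma badly_approximable_shift:
  assumes "badly_approximable \<alpha>"
  shows "badly_approximable (of_int k + \<alpha>)"
proof -
  obtain c where c: "c > 0" "\<And>p q :: int. (p, q) \<noteq> (0, 0) \<Longrightarrow>
      c \<le> \<bar>of_int p - \<alpha> * of_int q\<bar> * of_int (max \<bar>p\<bar> \<bar>q\<bar>)"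
    using assms unfolding badly_approximable_def by blast
  define K where "K = 1 + \<bar>k\<bar>"
  have K: "real_of_int K > 0" by (simp add: K_def)
  have "c / K \<le> \<bar>of_int p - (of_int k + \<alpha>) * of_int q\<bar> * of_int (max \<bar>p\<bar> \<bar>q\<bar>)"
    if "(p, q) \<noteq> (0, 0)" for p q :: int
  proof -
    define m where "m = max \<bar>p\<bar> \<bar>q\<bar>"
    have "\<bar>k * q\<bar> \<le> \<bar>k\<bar> * m" by (simp add: abs_mult m_def mult_left_mono)
    moreover have "\<bar>p\<bar> \<le> m" "\<bar>q\<bar> \<le> m" "0 \<le> \<bar>k\<bar> * m" by (auto simp: m_def)
    ultimately have "max \<bar>p - k * q\<bar> \<bar>q\<bar> \<le> K * m" by (auto simp: K_def algebra_simps)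
    then have le: "real_of_int (max \<bar>p - k * q\<bar> \<bar>q\<bar>) \<le> of_int K * of_int m"
      by (metis of_int_le_iff of_int_mult)
    have "c \<le> \<bar>of_int (p - k * q) - \<alpha> * of_int q\<bar> * of_int (max \<bar>p - k * q\<bar> \<bar>q\<bar>)"
      using that by (intro c(2)) auto
    also have "\<dots> \<le> \<bar>of_int (p - k * q) - \<alpha> * of_int q\<bar> * (of_int K * of_int m)"
      by (intro mult_left_mono le) auto
    also have "of_int (p - k * q) - \<alpha> * of_int q = of_int p - (of_int k + \<alpha>) * of_int q"
      by (simp add: algebra_simps)
    finally show ?thesis using K by (simp add: m_def field_simps)
  qed
  then show ?thesis
    unfolding badly_approximable_def using c(1) K by (intro exI[of _ "c / K"]) auto
qed

text \<open>
  For positive \<open>p\<close> and \<open>q\<close> this is the previous descent with \<open>\<gamma> = 0\<close>.  For \<open>q > 0 \<ge> p\<close> and for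
  \<open>q = 0\<close> the linear factor is at least \<open>1\<close>, and the remaining vectors are negatives of these.
\<close>
lemma badly_approximable_of_cf:
  assumes "has_inf_cf \<alpha> a" "\<And>k. 1 \<le> a k" "\<And>k. a k \<le> M"
  shows "badly_approximable \<alpha>"
proof -
  define c where "c = 1 / ((real_of_int M + 1) * (of_int M + 2))"
  have M: "1 \<le> M" using assms(2)[of 0] assms(3)[of 0] by simp
  then have c: "0 < c" "c \<le> 1" unfolding c_def
    by (auto simp: mult_le_one intro!: divide_le_eq_1_pos[THEN iffD2] mult_ge1_I)
  have \<alpha>: "1 \<le> \<alpha>"
    using assms(1) cf_value_bounds[of a, OF assms(2)] unfolding has_inf_cf_def
    by (auto intro!: tendsto_lowerbound[of "cf_value a" \<alpha> sequentially])
  have *: "c \<le> \<bar>of_int p - \<alpha> * of_int q\<bar> * of_int (max \<bar>p\<bar> \<bar>q\<bar>)"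
    if "0 < q \<or> q = 0 \<and> p \<noteq> 0" for p q :: int
  proof (cases "0 < q \<and> 0 < p")
    case True
    have "c \<le> \<bar>of_int p - \<alpha> * of_int q\<bar> * (of_int p + 0 * of_int q) / (\<alpha> + 0)"
      unfolding c_def using True by (intro cf_form_lower_bound[OF assms]) auto
    also have "\<dots> \<le> \<bar>of_int p - \<alpha> * of_int q\<bar> * of_int p"
      using \<alpha> True mult_left_mono[of 1 \<alpha> "\<bar>of_int p - \<alpha> * of_int q\<bar> * of_int p"]
      by (simp add: divide_le_eq)
    also have "\<dots> \<le> \<bar>of_int p - \<alpha> * of_int q\<bar> * of_int (max \<bar>p\<bar> \<bar>q\<bar>)"
      by (intro mult_left_mono) auto
    finally show ?thesis .
  next
    case False
    have "1 \<le> \<bar>of_int p - \<alpha> * of_int q\<bar>"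
    proof (cases "q = 0")
      case True
      then show ?thesis using that by (simp flip: of_int_abs)
    next
      case q: False
      then have "1 \<le> real_of_int q" "real_of_int p \<le> 0" using that False by auto
      moreover from this have "1 * 1 \<le> \<alpha> * real_of_int q"
        using \<alpha> by (intro mult_mono) auto
      ultimately show ?thesis by linarith
    qed
    moreover have "1 \<le> max \<bar>p\<bar> \<bar>q\<bar>" using that by auto
    then have "1 \<le> real_of_int (max \<bar>p\<bar> \<bar>q\<bar>)" by (metis of_int_1_le_iff)
    ultimately have "1 * 1 \<le> \<bar>of_int p - \<alpha> * of_int q\<bar> * of_int (max \<bar>p\<bar> \<bar>q\<bar>)"
      by (intro mult_mono) auto
    then show ?thesis using c(2) by linarith
  qed
  have "c \<le> \<bar>of_int p - \<alpha> * of_int q\<bar> * of_int (max \<bar>p\<bar> \<bar>q\<bar>)"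
    if "(p, q) \<noteq> (0, 0)" for p q :: int
  proof (cases "0 < q \<or> q = 0 \<and> p \<noteq> 0")
    case True
    then show ?thesis by (rule *)
  next
    case False
    then have "c \<le> \<bar>of_int (-p) - \<alpha> * of_int (-q)\<bar> * of_int (max \<bar>-p\<bar> \<bar>-q\<bar>)"
      using that by (intro *) auto
    moreover have "\<bar>of_int (-p) - \<alpha> * of_int (-q)\<bar> = \<bar>of_int p - \<alpha> * of_int q\<bar>" by simp
    ultimately show ?thesis by simp
  qed
  then show ?thesis unfolding badly_approximable_def using c(1) by blast
qed

text \<open>
  The leading element may be any integer, whereas the descent needs a positive one; translating
  \<open>\<alpha>\<close> by an integer replaces it by \<open>1\<close>.
\<close>
lemma has_inf_cf_shift:
  assumes "has_inf_cf \<alpha> a"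
  shows "has_inf_cf (\<alpha> - of_int (a 0 - 1)) (a(0 := 1))"
proof -
  have "cf_value (a(0 := 1)) n = cf_value a n - of_int (a 0 - 1)" for n
    by (cases n) (auto simp: fun_upd_def)
  then have eq: "cf_value (a(0 := 1)) = (\<lambda>n. cf_value a n - of_int (a 0 - 1))" by (rule ext)
  have "cf_value a \<longlonglongrightarrow> \<alpha>" using assms by (simp add: has_inf_cf_def)
  then have "cf_value (a(0 := 1)) \<longlonglongrightarrow> \<alpha> - of_int (a 0 - 1)"
    unfolding eq by (intro tendsto_diff tendsto_const)
  then show ?thesis using assms by (simp add: has_inf_cf_def)
qed

lemma bounded_inf_cf_badly_approximable:
  assumes "bounded_inf_cf \<alpha>"
  shows "badly_approximable \<alpha>"
proof -
  obtain a M where a: "has_inf_cf \<alpha> a" "\<And>k. \<bar>a k\<bar> \<le> M"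
    using assms unfolding bounded_inf_cf_def by blast
  have "badly_approximable (\<alpha> - of_int (a 0 - 1))"
  proof (rule badly_approximable_of_cf[OF has_inf_cf_shift[OF a(1)]])
    fix k
    show "1 \<le> (a(0 := 1)) k" using a(1) by (simp add: has_inf_cf_def)
    show "(a(0 := 1)) k \<le> max M 1" using a(2)[of k] by auto
  qed
  from badly_approximable_shift[OF this, of "a 0 - 1"] show ?thesis by simp
qed

text \<open>
  Because \<open>\<alpha>\<close> is real, the real and the imaginary part of \<open>y - \<alpha> x\<close> are the same linear
  form at the real and at the imaginary part of the vector.  One of these integer vectors is nonzero,
  and it is no longer than the Gaussian vector itself.
\<close>
lemma badly_approximable_gauss:
  assumes "badly_approximable \<alpha>"
  obtains c where "c > 0"
    "\<And>v. gauss_vec v \<Longrightarrow> v \<noteq> 0 \<Longrightarrow> c \<le> cmod (v $ 2 - of_real \<alpha> * v $ 1) * max_abs v"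
proof -
  obtain c where c: "c > 0" "\<And>p q :: int. (p, q) \<noteq> (0, 0) \<Longrightarrow>
      c \<le> \<bar>of_int p - \<alpha> * of_int q\<bar> * of_int (max \<bar>p\<bar> \<bar>q\<bar>)"
    using assms unfolding badly_approximable_def by blast
  have part: "c \<le> cmod (v $ 2 - of_real \<alpha> * v $ 1) * max_abs v"
    if pq: "(p, q) \<noteq> (0, 0)"
      and v: "\<bar>real_of_int p\<bar> \<le> cmod (v $ 2)" "\<bar>real_of_int q\<bar> \<le> cmod (v $ 1)"
        "\<bar>real_of_int p - \<alpha> * of_int q\<bar> \<le> cmod (v $ 2 - of_real \<alpha> * v $ 1)"
      for p q :: int and v :: "complex^2"
  proof -
    have "real_of_int (max \<bar>p\<bar> \<bar>q\<bar>) \<le> max_abs v"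
      using v(1,2) by (auto simp: max_abs_def of_int_max)
    then have "\<bar>of_int p - \<alpha> * of_int q\<bar> * of_int (max \<bar>p\<bar> \<bar>q\<bar>)
        \<le> cmod (v $ 2 - of_real \<alpha> * v $ 1) * max_abs v"
      using v(3) by (intro mult_mono) auto
    then show ?thesis using c(2)[OF pq] by linarith
  qed
  show thesis
  proof (rule that[OF c(1)])
    fix v :: "complex^2"
    assume v: "gauss_vec v" "v \<noteq> 0"
    have "v $ 1 \<in> gauss_ints" "v $ 2 \<in> gauss_ints" using v(1) by (auto simp: gauss_vec_def)
    then obtain p q p' q' :: int where
      eqs: "Re (v $ 2) = p" "Re (v $ 1) = q" "Im (v $ 2) = p'" "Im (v $ 1) = q'"
      unfolding gauss_ints_def by (auto elim!: Ints_cases)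
    have "(p, q) \<noteq> (0, 0) \<or> (p', q') \<noteq> (0, 0)"
      using v(2) eqs by (auto simp: vec_eq_iff forall_2 complex_eq_iff)
    then show "c \<le> cmod (v $ 2 - of_real \<alpha> * v $ 1) * max_abs v"
    proof
      assume "(p, q) \<noteq> (0, 0)"
      then show ?thesis
        by (rule part)
          (use abs_Re_le_cmod[of "v $ 2"] abs_Re_le_cmod[of "v $ 1"]
             abs_Re_le_cmod[of "v $ 2 - of_real \<alpha> * v $ 1"] eqs in auto)
    next
      assume "(p', q') \<noteq> (0, 0)"
      then show ?thesis
        by (rule part)
          (use abs_Im_le_cmod[of "v $ 2"] abs_Im_le_cmod[of "v $ 1"]
             abs_Im_le_cmod[of "v $ 2 - of_real \<alpha> * v $ 1"] eqs in auto)
    qed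
  qed
qed

text \<open>
  Dirichlet's theorem with bound \<open>M\<close> gives \<open>\<bar>q \<alpha> - p\<bar> < 1/M\<close> for some \<open>q \<le> M\<close>; bad approximability
  then forces \<open>q\<close> to be at least a constant times \<open>M\<close>, so that \<open>\<bar>\<alpha> - p/q\<bar>\<close> is of order \<open>1/M\<^sup>2\<close>.  The
  choice \<open>M = N div T\<close> with \<open>T \<ge> \<bar>\<alpha>\<bar> + 1\<close> keeps the numerator at most \<open>N\<close> as well.
\<close>
lemma badly_approximable_quadratic_approx:
  assumes "badly_approximable \<alpha>"
  obtains C N0 where "C > 0" "\<And>N :: nat. N0 \<le> N \<Longrightarrow>
      \<exists>p q :: int. coprime p q \<and> 0 < q \<and> \<bar>p\<bar> \<le> int N \<and> q \<le> int N \<and>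
        \<bar>\<alpha> - of_int p / of_int q\<bar> \<le> C / (real N)\<^sup>2"
proof -
  obtain c where c: "c > 0" "\<And>p q :: int. (p, q) \<noteq> (0, 0) \<Longrightarrow>
      c \<le> \<bar>of_int p - \<alpha> * of_int q\<bar> * of_int (max \<bar>p\<bar> \<bar>q\<bar>)"
    using assms unfolding badly_approximable_def by blast
  define T where "T = nat \<lceil>\<bar>\<alpha>\<bar>\<rceil> + 1"
  have T: "\<bar>\<alpha>\<bar> + 1 \<le> real T" "1 \<le> T" unfolding T_def by linarith+
  define C where "C = 4 * real T ^ 3 / c"
  show thesis
  proof
    show "C > 0" using c(1) T by (simp add: C_def)
    fix N :: nat
    assume N: "T \<le> N"
    define M where "M = N div T"
    have "M > 0" using N T by (simp add: M_def div_greater_zero_iff)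
    then obtain p q where pq: "coprime p q" "0 < q" "q \<le> int M" "\<bar>of_int q * \<alpha> - of_int p\<bar> < 1 / M"
      by (rule Dirichlet_approx_coprime)
    have TM: "T * M \<le> N" by (simp add: M_def)
    have "N < T * M + T" using dividend_less_times_div[of T N] T(2) by (simp add: M_def add.commute)
    moreover have "T \<le> T * M" using \<open>M > 0\<close> by simp
    ultimately have "N \<le> 2 * (T * M)" by linarith
    then have "N \<le> 2 * T * M" by (simp only: mult.assoc)
    then have "real N \<le> real (2 * T * M)" by (rule of_nat_mono)
    then have NM: "real N \<le> 2 * real T * real M" by simp
    have q: "1 \<le> real_of_int q" using pq(2) by simp
    have "1 / real M \<le> 1" using \<open>M > 0\<close> by simp
    then have "\<bar>of_int p\<bar> \<le> \<bar>of_int q * \<alpha>\<bar> + real_of_int q" using pq(4) q by linarith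
    also have "\<dots> = (\<bar>\<alpha>\<bar> + 1) * real_of_int q" using q by (simp add: abs_mult algebra_simps)
    also have "\<dots> \<le> real T * real_of_int q" using T q by (intro mult_right_mono) auto
    finally have p: "\<bar>real_of_int p\<bar> \<le> real T * real_of_int q" .
    have qM: "real_of_int q \<le> real M" using pq(3) by linarith
    have "real_of_int \<bar>p\<bar> \<le> real T * real M"
      using p mult_left_mono[OF qM, of "real T"] by simp
    also have "\<dots> \<le> real N" using of_nat_mono[OF TM, where 'a = real] by simp
    finally have pN: "\<bar>p\<bar> \<le> int N" by linarith
    have "M \<le> N" by (simp add: M_def)
    then have qN: "q \<le> int N" using pq(3) by simp
    have "real_of_int q \<le> real T * real_of_int q" using T q mult_right_mono[of 1 "real T" "real_of_int q"] by simp
    with p have mx: "real_of_int (max \<bar>p\<bar> \<bar>q\<bar>) \<le> real T * real_of_int q"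
      using q by (simp add: of_int_max)
    have "c \<le> \<bar>of_int p - \<alpha> * of_int q\<bar> * of_int (max \<bar>p\<bar> \<bar>q\<bar>)"
      using pq(2) by (intro c(2)) auto
    also have "\<dots> \<le> (1 / M) * (real T * real_of_int q)"
      using pq(4) mx by (intro mult_mono) (auto simp: abs_minus_commute mult.commute)
    finally have big: "c * real M \<le> real T * real_of_int q"
      using \<open>M > 0\<close> by (simp add: field_simps)
    have "\<alpha> - of_int p / of_int q = (of_int q * \<alpha> - of_int p) / of_int q"
      using q by (simp add: diff_divide_distrib)
    then have "\<bar>\<alpha> - of_int p / of_int q\<bar> = \<bar>of_int q * \<alpha> - of_int p\<bar> / of_int q"
      using q by (simp add: abs_divide)
    also have "\<dots> \<le> (1 / M) / of_int q"
      using pq(4) q by (intro divide_right_mono) auto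
    also have "\<dots> \<le> (1 / M) / (c * real M / real T)"
      using big c(1) T \<open>M > 0\<close> q by (intro divide_left_mono mult_pos_pos) (auto simp: field_simps)
    also have "\<dots> = real T / (c * (real M)\<^sup>2)"
      using c(1) T \<open>M > 0\<close> by (simp add: field_simps power2_eq_square)
    also have "\<dots> \<le> C / (real N)\<^sup>2"
    proof -
      have "(real N)\<^sup>2 \<le> (2 * real T * real M)\<^sup>2" using NM by (intro power_mono) auto
      then have "real T * (real N)\<^sup>2 \<le> real T * (2 * real T * real M)\<^sup>2"
        by (intro mult_left_mono) auto
      also have "\<dots> = (4 * real T ^ 3) * (real M)\<^sup>2"
        by (simp add: power2_eq_square power3_eq_cube)
      finally have "real T * (real N)\<^sup>2 \<le> (4 * real T ^ 3) * (real M)\<^sup>2" .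
      then show ?thesis using c(1) T N \<open>M > 0\<close> by (simp add: C_def field_simps)
    qed
    finally have "\<bar>\<alpha> - of_int p / of_int q\<bar> \<le> C / (real N)\<^sup>2" .
    with pq(1,2) pN qN
    show "\<exists>p q :: int. coprime p q \<and> 0 < q \<and> \<bar>p\<bar> \<le> int N \<and> q \<le> int N \<and>
        \<bar>\<alpha> - of_int p / of_int q\<bar> \<le> C / (real N)\<^sup>2" by blast
  qed
qed

section \<open>Eigenspaces of commuting regular operators\<close>

text \<open>
  For \<open>u \<noteq> 0\<close> these are the multiples of \<open>u\<close>.  The equation, a vanishing determinant, makes
  membership a polynomial identity.
\<close>
definition spanned_line :: "complex^2 \<Rightarrow> (complex^2) set" where
  "spanned_line u = {v. v $ 1 * u $ 2 = v $ 2 * u $ 1}"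

lemma spanned_line_iff:
  assumes "u \<noteq> 0"
  shows "v \<in> spanned_line u \<longleftrightarrow> (\<exists>c. v = c *s u)"
proof
  assume v: "v \<in> spanned_line u"
  show "\<exists>c. v = c *s u"
  proof (cases "u $ 1 = 0")
    case True
    then have "u $ 2 \<noteq> 0" using assms by (auto simp: vec_eq_iff forall_2)
    then have "v = (v $ 2 / u $ 2) *s u" using v True by (auto simp: spanned_line_def vec_eq_iff forall_2)
    then show ?thesis ..
  next
    case False
    then have "v = (v $ 1 / u $ 1) *s u" using v by (auto simp: spanned_line_def vec_eq_iff forall_2 field_simps)
    then show ?thesis ..
  qed
qed (auto simp: spanned_line_def)

lemma spanned_line_eqI:
  assumes "v \<in> spanned_line u" "v \<noteq> 0" "u \<noteq> 0"
  shows "spanned_line v = spanned_line u"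
proof -
  obtain c where c: "v = c *s u" using assms spanned_line_iff by blast
  then have "c \<noteq> 0" using assms(2) by auto
  then show ?thesis unfolding c spanned_line_def by (auto simp: algebra_simps)
qed

lemma mem_eigenspace_iff:
  "v \<in> eigenspace A e \<longleftrightarrow>
     of_real (A$1$1) * v$1 + of_real (A$1$2) * v$2 = e * v$1 \<and>
     of_real (A$2$1) * v$1 + of_real (A$2$2) * v$2 = e * v$2"
  by (auto simp: eigenspace_def complexify_def map_matrix_def matrix_vector_mult_def
      vec_eq_iff forall_2 sum_2)

lemma eigval_iff:
  "eigval A e \<longleftrightarrow> (\<exists>u. u \<noteq> 0 \<and> u \<in> eigenspace A e)"
  by (auto simp: eigval_def eigenspace_def)

lemma eigenspace_inter:
  assumes "c \<noteq> d" "v \<in> eigenspace A c" "v \<in> eigenspace A d"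
  shows "v = 0"
proof -
  have "c * v$1 = d * v$1" "c * v$2 = d * v$2" using assms(2,3) by (auto simp: mem_eigenspace_iff)
  then show ?thesis using assms(1) by (auto simp: vec_eq_iff forall_2)
qed

lemma eigenspace_scale: "v \<in> eigenspace A c \<Longrightarrow> k *s v \<in> eigenspace A c"
  unfolding mem_eigenspace_iff
  by (auto simp: algebra_simps) (metis distrib_left mult.left_commute)+

text \<open>
  An operator with two independent eigenvectors for the same eigenvalue is scalar: by Cramer's rule the
  entries of \<open>A - c\<close> times the determinant of the two vectors vanish.
\<close>
lemma eigenspace_scalar:
  assumes "v \<in> eigenspace A c" "w \<in> eigenspace A c" "v $ 1 * w $ 2 \<noteq> v $ 2 * w $ 1"
  shows "of_real (A$1$1) = c" "of_real (A$1$2) = (0::complex)" "of_real (A$2$1) = (0::complex)" "of_real (A$2$2) = c"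
proof -
  let ?a = "of_real (A$1$1) - c" and ?b = "of_real (A$1$2) :: complex"
  let ?c = "of_real (A$2$1) :: complex" and ?d = "of_real (A$2$2) - c"
  have e: "?a * v$1 + ?b * v$2 = 0" "?a * w$1 + ?b * w$2 = 0"
     "?c * v$1 + ?d * v$2 = 0" "?c * w$1 + ?d * w$2 = 0"
    using assms(1,2) by (auto simp: mem_eigenspace_iff algebra_simps)
  let ?D = "v $ 1 * w $ 2 - v $ 2 * w $ 1"
  have D: "?D \<noteq> 0" using assms(3) by simp
  have "?a * ?D = 0" "?b * ?D = 0" "?c * ?D = 0" "?d * ?D = 0" using e by algebra+
  then show "of_real (A$1$1) = c" "of_real (A$1$2) = (0::complex)" "of_real (A$2$1) = (0::complex)" "of_real (A$2$2) = c"
    using D by auto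
qed

lemma eigenspace_eq_spanned_line:
  assumes "regular A" "u \<noteq> 0" "u \<in> eigenspace A c"
  shows "eigenspace A c = spanned_line u"
proof
  show "spanned_line u \<subseteq> eigenspace A c"
    using assms(2,3) spanned_line_iff eigenspace_scale by auto
  show "eigenspace A c \<subseteq> spanned_line u"
  proof (rule subsetI, rule ccontr)
    fix v assume v: "v \<in> eigenspace A c" "v \<notin> spanned_line u"
    then have "v $ 1 * u $ 2 \<noteq> v $ 2 * u $ 1" by (simp add: spanned_line_def)
    from eigenspace_scalar[OF v(1) assms(3) this]
    have "eigval A d \<Longrightarrow> d = c" for d
      unfolding eigval_iff mem_eigenspace_iff by (auto simp: vec_eq_iff forall_2)
    then show False using assms(1) unfolding regular_def by blast
  qed
qed

text \<open>
  All three numbers are roots of the characteristic polynomial, which is monic of degree two.  Comparing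
  its values at \<open>c\<close>, \<open>d\<close> and \<open>e\<close> gives \<open>(e - c) (e - d) (c - d) = 0\<close>.
\<close>
lemma regular_two_eigvals:
  assumes "c \<noteq> d" "eigval A c" "eigval A d" "eigval A e"
  shows "e = c \<or> e = d"
proof -
  have det: "(of_real (A$1$1) - e) * (of_real (A$2$2) - e) = of_real (A$1$2) * (of_real (A$2$1) :: complex)"
    if ev: "eigval A e" for e
  proof -
    obtain u where u: "u \<noteq> 0" and "u \<in> eigenspace A e" using ev eigval_iff by auto
    then have e: "(of_real (A$1$1) - e) * u$1 + of_real (A$1$2) * u$2 = 0"
      "of_real (A$2$1) * u$1 + (of_real (A$2$2) - e) * u$2 = 0"
      by (auto simp: mem_eigenspace_iff algebra_simps)
    let ?D = "(of_real (A$1$1) - e) * (of_real (A$2$2) - e) - of_real (A$1$2) * (of_real (A$2$1) :: complex)"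
    have "?D * u$1 = 0" "?D * u$2 = 0" using e by algebra+
    then show ?thesis using u by (auto simp: vec_eq_iff forall_2)
  qed
  have "(e - c) * (e - d) * (c - d) = 0"
    using det[OF assms(2)] det[OF assms(3)] det[OF assms(4)] by algebra
  then show ?thesis using assms(1) by simp
qed

text \<open>
  \<open>B\<close> preserves the eigenspaces of \<open>A\<close>; as these are lines, they consist of eigenvectors of \<open>B\<close>, and
  the eigenspaces of \<open>B\<close> are lines as well.
\<close>
lemma commuting_eigenspace:
  assumes "A ** B = B ** A" "regular A" "regular B" "eigval A c"
  shows "\<exists>e. eigval B e \<and> eigenspace A c = eigenspace B e"
proof -
  obtain u where u: "u \<noteq> 0" "u \<in> eigenspace A c" using assms(4) eigval_iff by auto
  have com: "complexify A ** complexify B = complexify B ** complexify A"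
  proof -
    have "complexify A ** complexify B = complexify (A ** B)" for A B
      by (simp add: complexify_def map_matrix_def matrix_matrix_mult_def vec_eq_iff)
    then show ?thesis using assms(1) by simp
  qed
  have "complexify A *v (complexify B *v u) = complexify B *v (complexify A *v u)"
    by (simp add: matrix_vector_mul_assoc com)
  also have "\<dots> = c *s (complexify B *v u)"
    using u by (simp add: eigenspace_def vector_scalar_commute)
  finally have "complexify B *v u \<in> eigenspace A c" by (simp add: eigenspace_def)
  then have "complexify B *v u \<in> spanned_line u" using eigenspace_eq_spanned_line assms(2) u by simp
  then obtain e where "complexify B *v u = e *s u" using u spanned_line_iff by auto
  then have "u \<in> eigenspace B e" by (simp add: eigenspace_def)
  then show ?thesis
    using eigenspace_eq_spanned_line[OF assms(2) u] eigenspace_eq_spanned_line[OF assms(3) u(1)] u(1) eigval_iff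
    by metis
qed

text \<open>
  Any single regular element determines the common pair of eigenspaces.
\<close>
lemma eigenspaces_commuting_set:
  assumes "\<And>A B. A \<in> H \<Longrightarrow> B \<in> H \<Longrightarrow> A ** B = B ** A" "A \<in> H" "c \<noteq> d" "eigval A c" "eigval A d"
  shows "eigenspaces H = {eigenspace A c, eigenspace A d}"
proof
  have reg: "regular A" using assms(3-5) unfolding regular_def by blast
  show "eigenspaces H \<subseteq> {eigenspace A c, eigenspace A d}"
    using assms(2) reg regular_two_eigvals[OF assms(3-5)] unfolding eigenspaces_def by blast
  show "{eigenspace A c, eigenspace A d} \<subseteq> eigenspaces H"
    unfolding eigenspaces_def using commuting_eigenspace[OF assms(1) reg] assms(2,4,5) by blast
qed

lemma comm_subgroup_commute:
  assumes "comm_subgroup H" "A \<in> H" "B \<in> H"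
  shows "A ** B = B ** A"
proof -
  interpret comm_group "GL2\<lparr>carrier := H\<rparr>" using assms(1) by (simp add: comm_subgroup_def)
  show ?thesis using m_comm[of A B] assms(2,3) by (simp add: GL2_def)
qed

lemma mcrs_group_eigenspaces:
  assumes "mcrs_group H"
  obtains u1 u2 where "u1 \<noteq> 0" "u2 \<noteq> 0" "spanned_line u1 \<noteq> spanned_line u2" "eigenspaces H = {spanned_line u1, spanned_line u2}"
proof -
  obtain A where A: "A \<in> H" "regular A" and H: "comm_subgroup H" using assms by (auto simp: mcrs_group_def)
  then obtain c d where cd: "c \<noteq> d" "eigval A c" "eigval A d" by (auto simp: regular_def)
  then obtain u1 u2 where u: "u1 \<noteq> 0" "u1 \<in> eigenspace A c" "u2 \<noteq> 0" "u2 \<in> eigenspace A d"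
    by (auto simp: eigval_iff)
  have eqs: "eigenspace A c = spanned_line u1" "eigenspace A d = spanned_line u2"
    using eigenspace_eq_spanned_line[OF A(2) u(1,2)] eigenspace_eq_spanned_line[OF A(2) u(3,4)] by simp_all
  have "spanned_line u1 \<noteq> spanned_line u2"
    using eigenspace_inter[OF cd(1), of u1 A] u eqs by auto
  moreover have "eigenspaces H = {spanned_line u1, spanned_line u2}"
    using eigenspaces_commuting_set[OF comm_subgroup_commute[OF H] A(1) cd] eqs by simp
  ultimately show thesis using that u by blast
qed

section \<open>Markoff-Davenport forms and the discrepancy\<close>

text \<open>
  The linear form with coefficients \<open>(u\<^sub>2, - u\<^sub>1)\<close> vanishes on the line spanned by \<open>u\<close>; multiplying
  out two such forms gives the coefficients of the quadratic form.
\<close>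
lemma ex_md_form:
  assumes "eigenspaces H = {spanned_line u1, spanned_line u2}" "spanned_line u1 \<noteq> spanned_line u2" "u1 \<noteq> 0" "u2 \<noteq> 0"
  shows "\<exists>q. is_md_form H q"
proof -
  define L :: "complex^2 \<Rightarrow> complex^2" where "L = (\<lambda>u. vector [u $ 2, - u $ 1])"
  have L: "L u \<noteq> 0" if "u \<noteq> 0" for u
    using that by (auto simp: L_def vec_eq_iff forall_2)
  have van: "lin_form (L u) v = 0" if "v \<in> spanned_line u" for u v
    using that by (auto simp: L_def lin_form_def spanned_line_def mult.commute)
  let ?A = "L u2" and ?B = "L u1"
  define q :: "complex^3" where "q = vector [?A$1 * ?B$1 / form_det ?A ?B,
     (?A$1 * ?B$2 + ?A$2 * ?B$1) / form_det ?A ?B, ?A$2 * ?B$2 / form_det ?A ?B]"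
  have "quad_form q v = lin_form ?A v * lin_form ?B v / form_det ?A ?B" for v
    by (simp add: q_def quad_form_def lin_form_def divide_inverse algebra_simps power2_eq_square)
  then have "is_md_form H q"
    unfolding is_md_form_def using assms L van
    by (intro exI[of _ "spanned_line u1"] exI[of _ "spanned_line u2"] exI[of _ ?A] exI[of _ ?B]) simp
  then show ?thesis ..
qed

lemma md_form_is_md_form:
  assumes "mcrs_group H"
  shows "is_md_form H (md_form H)"
proof -
  obtain u1 u2 where "u1 \<noteq> 0" "u2 \<noteq> 0" "spanned_line u1 \<noteq> spanned_line u2" "eigenspaces H = {spanned_line u1, spanned_line u2}"
    using mcrs_group_eigenspaces[OF assms] .
  then have "\<exists>q. is_md_form H q" by (intro ex_md_form)
  then show ?thesis unfolding md_form_def by (rule someI_ex)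
qed

lemma md_form_vanishes:
  assumes "mcrs_group H" "l \<in> eigenspaces H" "v \<in> l"
  shows "quad_form (md_form H) v = 0"
  using md_form_is_md_form[OF assms(1)] assms(2,3) unfolding is_md_form_def by auto

text \<open>
  The form sees a group only through its eigenspaces.  This is what reduces the search for a best
  approximation to finitely many cases.
\<close>
lemma md_form_cong: "eigenspaces H = eigenspaces K \<Longrightarrow> md_form H = md_form K"
  by (simp add: md_form_def is_md_form_def)

text \<open>
  The Markoff-Davenport form of the pair of lines \<open>y = a x\<close>, \<open>y = b x\<close>, with one choice of sign; it
  factors as \<open>(y - a x) (y - b x) / (a - b)\<close>.
\<close>
definition slope_form :: "real \<Rightarrow> real \<Rightarrow> complex^3" where
  "slope_form a b = vector [of_real (a * b / (a - b)), of_real (- (a + b) / (a - b)), of_real (1 / (a - b))]"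

lemma quad_form_slope_form:
  "quad_form (slope_form a b) v
     = (v $ 2 - of_real a * v $ 1) * (v $ 2 - of_real b * v $ 1) / of_real (a - b)"
  by (simp add: slope_form_def quad_form_def divide_inverse algebra_simps power2_eq_square)

lemma quad_form_eqI:
  assumes "\<And>v. quad_form p v = quad_form q v"
  shows "p = q"
proof -
  have "p $ 1 = q $ 1" using assms[of "vector [1, 0]"] by (simp add: quad_form_def)
  moreover have "p $ 3 = q $ 3" using assms[of "vector [0, 1]"] by (simp add: quad_form_def)
  ultimately show ?thesis
    using assms[of "vector [1, 1]"] by (simp add: quad_form_def vec_eq_iff forall_3)
qed

lemma slope_form_commute: "slope_form b a = - slope_form a b"
proof (rule quad_form_eqI)
  fix v
  have "quad_form (- slope_form a b) v = - quad_form (slope_form a b) v"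
    by (simp add: quad_form_def)
  moreover have "complex_of_real (b - a) = - of_real (a - b)" by simp
  ultimately show "quad_form (slope_form b a) v = quad_form (- slope_form a b) v"
    unfolding quad_form_slope_form by (simp only: divide_minus_right mult.commute)
qed

lemma lin_form_vanishing_on_slope_line:
  assumes "L \<noteq> 0" "\<forall>v\<in>slope_line s. lin_form L v = 0"
  obtains k where "k \<noteq> 0" "L $ 1 = - (k * of_real s)" "L $ 2 = k"
proof -
  have "vector [1, of_real s] \<in> slope_line s" by (simp add: slope_line_def)
  then have "L $ 1 + L $ 2 * of_real s = 0" using assms(2) by (force simp: lin_form_def)
  then have eq: "L $ 1 = - (L $ 2 * of_real s)" by (simp add: add_eq_0_iff2)
  then have "L $ 2 \<noteq> 0" using assms(1) by (auto simp: vec_eq_iff forall_2)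
  then show thesis using that eq by blast
qed

text \<open>
  The sign is decided by the order in which the two lines are listed.
\<close>
lemma md_form_of_slope_lines:
  assumes "mcrs_group H" "eigenspaces H = {slope_line a, slope_line b}" "a \<noteq> b"
  shows "md_form H = slope_form a b \<or> md_form H = - slope_form a b"
proof -
  obtain l1 l2 L1 L2 where l: "eigenspaces H = {l1, l2}" "l1 \<noteq> l2"
    and L1: "L1 \<noteq> 0" "\<forall>v\<in>l2. lin_form L1 v = 0" and L2: "L2 \<noteq> 0" "\<forall>v\<in>l1. lin_form L2 v = 0"
    and q: "\<And>v. quad_form (md_form H) v = lin_form L1 v * lin_form L2 v / form_det L1 L2"
    using md_form_is_md_form[OF assms(1)] unfolding is_md_form_def by blast
  have *: "md_form H = slope_form s t" if st: "l1 = slope_line s" "l2 = slope_line t" "s \<noteq> t" for s t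
  proof (rule quad_form_eqI)
    fix v
    obtain k where k: "k \<noteq> 0" "L1 $ 1 = - (k * of_real t)" "L1 $ 2 = k"
      using lin_form_vanishing_on_slope_line[OF L1[unfolded st(2)]] .
    obtain m where m: "m \<noteq> 0" "L2 $ 1 = - (m * of_real s)" "L2 $ 2 = m"
      using lin_form_vanishing_on_slope_line[OF L2[unfolded st(1)]] .
    have D: "form_det L1 L2 = k * m * of_real (s - t)"
      by (simp add: form_det_def det_2 k m algebra_simps)
    have n: "lin_form L1 v * lin_form L2 v
        = (k * m) * ((v $ 2 - of_real s * v $ 1) * (v $ 2 - of_real t * v $ 1))"
      by (simp add: lin_form_def k m algebra_simps)
    show "quad_form (md_form H) v = quad_form (slope_form s t) v"
      using k(1) m(1) unfolding q quad_form_slope_form D n by simp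
  qed
  have "l1 = slope_line a \<and> l2 = slope_line b \<or> l1 = slope_line b \<and> l2 = slope_line a"
    using l assms(2) by (auto simp: doubleton_eq_iff)
  then show ?thesis
    using *[of a b] *[of b a] assms(3) slope_form_commute[of b a] by auto
qed

lemma coeff_le_max_coeff: "cmod (q $ i) \<le> max_coeff q"
  unfolding max_coeff_def by (intro Max_ge) auto

lemma max_coeff_le: "(\<And>i. cmod (q $ i) \<le> c) \<Longrightarrow> max_coeff q \<le> c"
  unfolding max_coeff_def by (subst Max_le_iff) auto

lemma max_coeff_nonneg: "0 \<le> max_coeff q"
  using coeff_le_max_coeff[of q 1] norm_ge_zero order_trans by blast

lemma max_coeff_minus: "max_coeff (- q) = max_coeff q"
  by (simp add: max_coeff_def)

lemma max_abs_bounds: "cmod (v $ 1) \<le> max_abs v" "cmod (v $ 2) \<le> max_abs v"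
  by (simp_all add: max_abs_def)

text \<open>
  The factor \<open>3\<close> counts the monomials.
\<close>
lemma cmod_quad_form_le: "cmod (quad_form q v) \<le> 3 * max_coeff q * (max_abs v)\<^sup>2"
proof -
  let ?M = "max_coeff q" and ?m = "max_abs v"
  note b = coeff_le_max_coeff[of q] max_abs_bounds[of v]
  have m0: "0 \<le> ?m" using max_abs_bounds(1)[of v] norm_ge_zero order_trans by blast
  have *: "cmod (q $ i * (x * y)) \<le> ?M * ?m\<^sup>2" if "cmod x \<le> ?m" "cmod y \<le> ?m" for i x y
    unfolding norm_mult power2_eq_square
    using b(1)[of i] that m0 max_coeff_nonneg[of q] by (intro mult_mono mult_nonneg_nonneg) auto
  have "cmod (quad_form q v) \<le> cmod (q $ 1 * (v $ 1 * v $ 1)) + cmod (q $ 2 * (v $ 1 * v $ 2))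
      + cmod (q $ 3 * (v $ 2 * v $ 2))"
    unfolding quad_form_def power2_eq_square by (intro norm_triangle_mono order_refl)
  also have "\<dots> \<le> ?M * ?m\<^sup>2 + ?M * ?m\<^sup>2 + ?M * ?m\<^sup>2"
    using b by (intro add_mono *) auto
  finally show ?thesis by simp
qed

text \<open>
  At a point of an eigenspace of \<open>K\<close> the form of \<open>K\<close> drops out of both the sum and the difference of
  the two forms, and what remains is the form of \<open>H\<close>.
\<close>
lemma cmod_md_form_le_discrepancy:
  assumes "mcrs_group K" "l \<in> eigenspaces K" "v \<in> l"
  shows "cmod (quad_form (md_form H) v) \<le> 3 * discrepancy H K * (max_abs v)\<^sup>2"
proof -
  have "quad_form (md_form H + md_form K) v = quad_form (md_form H) v"
    "quad_form (md_form H - md_form K) v = quad_form (md_form H) v"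
    using md_form_vanishes[OF assms] by (simp_all add: quad_form_def algebra_simps)
  then show ?thesis
    using cmod_quad_form_le[of "md_form H + md_form K" v] cmod_quad_form_le[of "md_form H - md_form K" v]
    unfolding discrepancy_def min_def by auto
qed

text \<open>
  Whatever signs are chosen for the two forms, their sum or their difference is
  \<open>slope_form a1 a2 - slope_form b1 b2\<close> up to sign.
\<close>
lemma discrepancy_le_slope_form:
  assumes "mcrs_group H" "eigenspaces H = {slope_line a1, slope_line a2}" "a1 \<noteq> a2"
    and "mcrs_group K" "eigenspaces K = {slope_line b1, slope_line b2}" "b1 \<noteq> b2"
  shows "discrepancy H K \<le> max_coeff (slope_form a1 a2 - slope_form b1 b2)"
proof -
  let ?p = "slope_form a1 a2" and ?q = "slope_form b1 b2"
  have neg: "max_coeff (- ?p - - ?q) = max_coeff (?p - ?q)" "max_coeff (- ?p + ?q) = max_coeff (?p - ?q)"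
    using max_coeff_minus[of "?p - ?q"] by simp_all
  show ?thesis
    using md_form_of_slope_lines[OF assms(1-3)] md_form_of_slope_lines[OF assms(4-6)] neg
    unfolding discrepancy_def by (auto simp: min_def)
qed

lemma abs_divide_diff_le:
  fixes n n' d d' :: real
  assumes "d \<noteq> 0" "\<bar>n - n'\<bar> \<le> P * t" "\<bar>d - d'\<bar> \<le> 2 * t" "\<bar>d\<bar> / 2 \<le> \<bar>d'\<bar>" "\<bar>n\<bar> \<le> Q"
  shows "\<bar>n / d - n' / d'\<bar> \<le> (2 * P / \<bar>d\<bar> + 4 * Q / d\<^sup>2) * t"
proof -
  have d': "0 < \<bar>d'\<bar>" "d' \<noteq> 0" and dd: "0 < \<bar>d\<bar>" using assms(1,4) by auto
  have t: "0 \<le> t" and Q: "0 \<le> Q" and Pt: "0 \<le> P * t" using assms(2,3,5) by linarith+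
  have "n / d - n' / d' = (n - n') / d' + n * (d' - d) / (d * d')"
    using assms(1) d'(2) by (simp add: divide_simps) (simp add: algebra_simps)
  then have "\<bar>n / d - n' / d'\<bar> \<le> \<bar>(n - n') / d'\<bar> + \<bar>n * (d' - d) / (d * d')\<bar>"
    by (simp only: abs_triangle_ineq)
  also have "\<dots> = \<bar>n - n'\<bar> / \<bar>d'\<bar> + \<bar>n\<bar> * \<bar>d - d'\<bar> / (\<bar>d\<bar> * \<bar>d'\<bar>)"
    by (simp add: abs_mult abs_minus_commute)
  also have "\<dots> \<le> (P * t) / (\<bar>d\<bar> / 2) + Q * (2 * t) / (\<bar>d\<bar> * (\<bar>d\<bar> / 2))"
  proof (rule add_mono)
    show "\<bar>n - n'\<bar> / \<bar>d'\<bar> \<le> (P * t) / (\<bar>d\<bar> / 2)"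
      using assms Pt dd by (intro frac_le) auto
    show "\<bar>n\<bar> * \<bar>d - d'\<bar> / (\<bar>d\<bar> * \<bar>d'\<bar>) \<le> Q * (2 * t) / (\<bar>d\<bar> * (\<bar>d\<bar> / 2))"
    proof (rule frac_le)
      show "0 \<le> Q * (2 * t)" using Q t by simp
      show "\<bar>n\<bar> * \<bar>d - d'\<bar> \<le> Q * (2 * t)" using assms(3,5) Q by (intro mult_mono) auto
      show "0 < \<bar>d\<bar> * (\<bar>d\<bar> / 2)" using dd by (intro mult_pos_pos) auto
      show "\<bar>d\<bar> * (\<bar>d\<bar> / 2) \<le> \<bar>d\<bar> * \<bar>d'\<bar>" by (rule mult_left_mono[OF assms(4)]) simp
    qed
  qed
  also have "\<dots> = (2 * P / \<bar>d\<bar> + 4 * Q / d\<^sup>2) * t"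
    by (simp add: power2_eq_square algebra_simps)
  finally show ?thesis .
qed

text \<open>
  All coefficients have the denominator \<open>a1 - a2\<close>, which stays at least half as large when both slopes
  move by at most a quarter of it.  In the proof, \<open>P\<close> is a Lipschitz constant for the three numerators
  \<open>a1 a2\<close>, \<open>- (a1 + a2)\<close>, \<open>1\<close> on the unit neighbourhood, and \<open>Q\<close> bounds their absolute values at \<open>(a1, a2)\<close>.
\<close>
lemma slope_form_locally_lipschitz:
  assumes "a1 \<noteq> a2"
  obtains \<eta> K where "\<eta> > 0" "K > 0"
    "\<And>b1 b2 t. \<bar>a1 - b1\<bar> \<le> t \<Longrightarrow> \<bar>a2 - b2\<bar> \<le> t \<Longrightarrow> t \<le> \<eta> \<Longrightarrow>
       b1 \<noteq> b2 \<and> max_coeff (slope_form a1 a2 - slope_form b1 b2) \<le> K * t"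
proof -
  define d where "d = a1 - a2"
  have d: "d \<noteq> 0" "0 < \<bar>d\<bar>" using assms by (auto simp: d_def)
  define P where "P = \<bar>a1\<bar> + \<bar>a2\<bar> + 2"
  define Q where "Q = \<bar>a1 * a2\<bar> + \<bar>a1 + a2\<bar> + 1"
  define K where "K = 2 * P / \<bar>d\<bar> + 4 * Q / d\<^sup>2"
  show thesis
  proof
    show "0 < min 1 (\<bar>d\<bar> / 4)" using d by simp
    have "0 < P" "0 < Q" unfolding P_def Q_def by linarith+
    then show "0 < K" unfolding K_def using d by (intro add_pos_pos divide_pos_pos) auto
    fix b1 b2 t :: real
    assume t: "\<bar>a1 - b1\<bar> \<le> t" "\<bar>a2 - b2\<bar> \<le> t" "t \<le> min 1 (\<bar>d\<bar> / 4)"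
    then have "t \<le> \<bar>d\<bar> / 4" by simp
    have dd1: "\<bar>d - (b1 - b2)\<bar> \<le> 2 * t" using t(1,2) unfolding d_def by linarith
    have dd2: "\<bar>d\<bar> / 2 \<le> \<bar>b1 - b2\<bar>"
      using abs_triangle_ineq2[of d "b1 - b2"] dd1 \<open>t \<le> \<bar>d\<bar> / 4\<close> by linarith
    note est = abs_divide_diff_le[OF d(1) _ dd1 dd2, of _ _ P Q, folded K_def]
    have t0: "0 \<le> t" using t by linarith
    have "a1 * a2 - b1 * b2 = a1 * (a2 - b2) + b2 * (a1 - b1)" by (simp add: algebra_simps)
    then have "\<bar>a1 * a2 - b1 * b2\<bar> \<le> \<bar>a1\<bar> * \<bar>a2 - b2\<bar> + \<bar>b2\<bar> * \<bar>a1 - b1\<bar>"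
      by (metis abs_mult abs_triangle_ineq)
    also have "\<dots> \<le> \<bar>a1\<bar> * t + (\<bar>a2\<bar> + 1) * t"
      using t by (intro add_mono mult_mono) auto
    also have "\<dots> \<le> P * t" using t0 by (simp add: P_def algebra_simps)
    finally have 1: "\<bar>a1 * a2 / d - b1 * b2 / (b1 - b2)\<bar> \<le> K * t"
      by (intro est) (auto simp: Q_def)
    have "2 * t \<le> P * t" using t0 by (intro mult_right_mono) (auto simp: P_def)
    then have 2: "\<bar>- (a1 + a2) / d - - (b1 + b2) / (b1 - b2)\<bar> \<le> K * t"
      using t by (intro est) (auto simp: Q_def)
    have 3: "\<bar>1 / d - 1 / (b1 - b2)\<bar> \<le> K * t"
      using t0 by (intro est) (auto simp: Q_def P_def)
    have cmod_diff: "cmod (of_real x - of_real y) = \<bar>x - y\<bar>" for x y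
      by (metis norm_of_real of_real_diff)
    have "cmod ((slope_form a1 a2 - slope_form b1 b2) $ i) \<le> K * t" for i
      using exhaust_3[of i] 1 2 3
      by (elim disjE)
        (simp_all only: slope_form_def vector_minus_component vector_3 cmod_diff d_def)
    moreover have "b1 \<noteq> b2" using dd2 d by auto
    ultimately show "b1 \<noteq> b2 \<and> max_coeff (slope_form a1 a2 - slope_form b1 b2) \<le> K * t"
      using max_coeff_le by blast
  qed
qed

section \<open>Primitive Gaussian vectors and the size of a line\<close>

lemma gauss_ints_mult: "x \<in> gauss_ints \<Longrightarrow> y \<in> gauss_ints \<Longrightarrow> x * y \<in> gauss_ints"
  by (auto simp: gauss_ints_def)

lemma gauss_ints_add: "x \<in> gauss_ints \<Longrightarrow> y \<in> gauss_ints \<Longrightarrow> x + y \<in> gauss_ints"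
  by (auto simp: gauss_ints_def)

lemma gauss_ints_of_int: "of_int n \<in> gauss_ints"
  by (simp add: gauss_ints_def)

lemma gauss_int_cmod_square:
  assumes "z \<in> gauss_ints"
  obtains n :: int where "(cmod z)\<^sup>2 = of_int n"
proof -
  obtain a b :: int where "Re z = a" "Im z = b"
    using assms by (auto simp: gauss_ints_def elim!: Ints_cases)
  then have "(cmod z)\<^sup>2 = of_int (a\<^sup>2 + b\<^sup>2)" by (simp add: cmod_power2)
  then show thesis by (rule that)
qed

lemma gauss_int_cmod_ge_1:
  assumes "z \<in> gauss_ints" "z \<noteq> 0"
  shows "1 \<le> cmod z"
proof -
  obtain n :: int where n: "(cmod z)\<^sup>2 = of_int n" by (rule gauss_int_cmod_square[OF assms(1)])
  have "0 < (cmod z)\<^sup>2" using assms(2) by simp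
  then have "1\<^sup>2 \<le> (cmod z)\<^sup>2" unfolding n by simp
  then show ?thesis by (rule power2_le_imp_le) simp
qed

text \<open>
  The squared modulus is a positive integer; if it were \<open>1\<close>, the conjugate would be an inverse.
\<close>
lemma gauss_int_nonunit_cmod:
  assumes "d \<in> gauss_ints" "d \<noteq> 0" "\<not> (\<exists>u\<in>gauss_ints. d * u = 1)"
  shows "2 \<le> (cmod d)\<^sup>2"
proof -
  obtain n :: int where n: "(cmod d)\<^sup>2 = of_int n" by (rule gauss_int_cmod_square[OF assms(1)])
  have "d * cnj d = of_real ((cmod d)\<^sup>2)" by (rule complex_norm_square[symmetric])
  moreover have "cnj d \<in> gauss_ints" using assms(1) by (simp add: gauss_ints_def)
  ultimately have "n \<noteq> 1" using assms(3) n by auto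
  moreover have "0 < (cmod d)\<^sup>2" using assms(2) by simp
  then have "0 < n" unfolding n by simp
  ultimately have "2 \<le> n" by simp
  then show ?thesis unfolding n by simp
qed

lemma primitive_vec_nonzero:
  assumes "primitive_vec v"
  shows "v \<noteq> 0"
proof
  assume "v = 0"
  have "0 \<in> gauss_ints" using gauss_ints_of_int[of 0] by simp
  then have "\<exists>u\<in>gauss_ints. 0 * u = (1 :: complex)"
    using assms \<open>v = 0\<close> unfolding primitive_vec_def by auto
  then show False by simp
qed

text \<open>
  A shortest nonzero Gaussian vector on the line is primitive: dividing by a common divisor that is not
  a unit would yield a Gaussian vector on the same line with at most half the squared length.
\<close>
lemma ex_primitive_vec:
  assumes "u \<noteq> 0" "w \<in> spanned_line u" "w \<noteq> 0" "gauss_vec w"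
  shows "\<exists>v\<in>spanned_line u. primitive_vec v"
proof -
  define f :: "complex^2 \<Rightarrow> real" where "f = (\<lambda>v. (cmod (v $ 1))\<^sup>2 + (cmod (v $ 2))\<^sup>2)"
  define P where "P = (\<lambda>v. v \<in> spanned_line u \<and> v \<noteq> 0 \<and> gauss_vec v)"
  have f1: "1 \<le> f v" if "P v" for v
  proof -
    have "v $ 1 \<noteq> 0 \<or> v $ 2 \<noteq> 0" "v $ 1 \<in> gauss_ints" "v $ 2 \<in> gauss_ints"
      using that by (auto simp: P_def vec_eq_iff forall_2 gauss_vec_def)
    then have "1 \<le> cmod (v $ 1) \<or> 1 \<le> cmod (v $ 2)" using gauss_int_cmod_ge_1 by blast
    then have "1 \<le> (cmod (v $ 1))\<^sup>2 \<or> 1 \<le> (cmod (v $ 2))\<^sup>2" by (auto intro: one_le_power)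
    moreover have "0 \<le> (cmod (v $ 1))\<^sup>2" "0 \<le> (cmod (v $ 2))\<^sup>2" by simp_all
    ultimately show ?thesis unfolding f_def by linarith
  qed
  have "P w" using assms by (simp add: P_def)
  \<comment> \<open>The floor makes the squared length a natural number.  It still decreases strictly under division
    by a non-unit, because the squared length drops by at least \<open>1\<close>.\<close>
  then obtain v where v: "P v" and min: "\<And>y. P y \<Longrightarrow> nat \<lfloor>f v\<rfloor> \<le> nat \<lfloor>f y\<rfloor>"
    using ex_has_least_nat[of P w "\<lambda>v. nat \<lfloor>f v\<rfloor>"] by blast
  have "primitive_vec v"
    unfolding primitive_vec_def
  proof (intro conjI ballI impI)
    show "gauss_vec v" using v by (simp add: P_def)
    fix d assume d: "d \<in> gauss_ints" "\<forall>i. \<exists>e\<in>gauss_ints. v $ i = d * e"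
    then obtain e where e: "\<And>i. e i \<in> gauss_ints" "\<And>i. v $ i = d * e i" by metis
    show "\<exists>u\<in>gauss_ints. d * u = 1"
    proof (rule ccontr)
      assume nu: "\<not> (\<exists>u\<in>gauss_ints. d * u = 1)"
      have ve: "v = d *s (\<chi> i. e i)" using e(2) by (simp add: vec_eq_iff)
      have "v \<noteq> 0" using v by (simp add: P_def)
      then have d0: "d \<noteq> 0" and "(\<chi> i. e i) \<noteq> 0" using ve by auto
      moreover have "(\<chi> i. e i) \<in> spanned_line u"
        using v d0 ve by (auto simp: P_def spanned_line_def)
      ultimately have Pe: "P (\<chi> i. e i)" using e(1) by (simp add: P_def gauss_vec_def)
      have "f v = (cmod d)\<^sup>2 * f (\<chi> i. e i)"
        by (simp add: f_def e(2) norm_mult power_mult_distrib distrib_left)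
      moreover have "2 * f (\<chi> i. e i) \<le> (cmod d)\<^sup>2 * f (\<chi> i. e i)"
        using gauss_int_nonunit_cmod[OF d(1) d0 nu] f1[OF Pe] by (intro mult_right_mono) auto
      ultimately have "f (\<chi> i. e i) + 1 \<le> f v" using f1[OF Pe] by linarith
      then have "nat \<lfloor>f (\<chi> i. e i)\<rfloor> < nat \<lfloor>f v\<rfloor>" using f1[OF Pe] by linarith
      then show False using min[OF Pe] by linarith
    qed
  qed
  then show ?thesis using v by (auto simp: P_def)
qed

text \<open>
  This makes the choice in the definition of the size of a line effective for the lines of a rational
  group.
\<close>
lemma line_size_attained:
  assumes "rational_group H" "l \<in> eigenspaces H"
  obtains v where "v \<in> l" "primitive_vec v" "max_abs v = line_size l"
proof -
  have H: "mcrs_group H" using assms(1) by (simp add: rational_group_def)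
  then obtain u where u: "u \<noteq> 0" "l = spanned_line u"
    using mcrs_group_eigenspaces assms(2) by (metis empty_iff insert_iff)
  obtain w where "w \<in> l" "w \<noteq> 0" "gauss_vec w"
    using assms unfolding rational_group_def by blast
  then have "\<exists>v. v \<in> l \<and> primitive_vec v" using ex_primitive_vec u by blast
  then have "(SOME v. v \<in> l \<and> primitive_vec v) \<in> l \<and> primitive_vec (SOME v. v \<in> l \<and> primitive_vec v)"
    by (rule someI_ex)
  then show thesis using that unfolding line_size_def by blast
qed

lemma finite_eigenspaces: "mcrs_group H \<Longrightarrow> finite (eigenspaces H)"
  using mcrs_group_eigenspaces by (metis finite.emptyI finite.insertI)

lemma line_size_le_size_mcrs:
  assumes "mcrs_group H" "l \<in> eigenspaces H"
  shows "line_size l \<le> size_mcrs H"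
  unfolding size_mcrs_def using assms finite_eigenspaces by (intro Max_ge) auto

text \<open>
  If \<open>a p + b q = 1\<close>, then every Gaussian vector \<open>v\<close> on the line is \<open>e\<close> times \<open>(q, p)\<close> with the Gaussian
  integer \<open>e = a v\<^sub>2 + b v\<^sub>1\<close>.  When \<open>v\<close> is primitive, \<open>e\<close> is a unit, so \<open>\<bar>e\<bar> \<le> 1\<close>.  The same Bezout identity
  shows that \<open>(q, p)\<close> is primitive among Gaussian vectors.
\<close>
lemma line_size_slope_line_le:
  fixes p q :: int
  assumes "coprime p q" "q > 0"
  shows "line_size (slope_line (of_int p / of_int q)) \<le> of_int (max \<bar>p\<bar> \<bar>q\<bar>)"
proof -
  let ?l = "slope_line (of_int p / of_int q)"
  obtain a b where ab: "a * p + b * q = 1"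
    using bezout_int[of p q] assms(1) by auto
  have "complex_of_int (a * p + b * q) = 1" unfolding ab by simp
  then have ab': "of_int a * of_int p + of_int b * of_int q = (1 :: complex)" by simp
  let ?w = "vector [of_int q, of_int p] :: complex^2"
  have "primitive_vec ?w"
    unfolding primitive_vec_def
  proof (intro conjI ballI impI)
    show "gauss_vec ?w" by (simp add: gauss_vec_def forall_2 gauss_ints_of_int)
    fix d assume "d \<in> gauss_ints" "\<forall>i. \<exists>e\<in>gauss_ints. ?w $ i = d * e"
    then obtain e f where ef: "e \<in> gauss_ints" "f \<in> gauss_ints" "of_int q = d * e" "of_int p = d * f"
      by (auto simp: forall_2)
    have "d * (of_int a * f + of_int b * e) = 1"
      using ab' unfolding ef(3,4) by (simp add: algebra_simps)
    then show "\<exists>u\<in>gauss_ints. d * u = 1"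
      using ef(1,2) gauss_ints_add gauss_ints_mult gauss_ints_of_int by blast
  qed
  moreover have "?w \<in> ?l" using assms(2) by (simp add: slope_line_def)
  ultimately have "\<exists>v. v \<in> ?l \<and> primitive_vec v" by blast
  from someI_ex[OF this] obtain v where v: "v \<in> ?l" "primitive_vec v" "line_size ?l = max_abs v"
    unfolding line_size_def by blast
  have rel: "of_int q * v $ 2 = of_int p * v $ 1"
    using v(1) assms(2) by (simp add: slope_line_def)
  define e where "e = of_int a * v $ 2 + of_int b * v $ 1"
  have "v $ 1 \<in> gauss_ints" "v $ 2 \<in> gauss_ints"
    using v(2) by (simp_all add: primitive_vec_def gauss_vec_def)
  then have e: "e \<in> gauss_ints"
    unfolding e_def by (intro gauss_ints_add gauss_ints_mult gauss_ints_of_int)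
  have v12: "v $ 1 = e * of_int q" "v $ 2 = e * of_int p"
    using rel ab' unfolding e_def by algebra+
  then have "\<forall>i. \<exists>f\<in>gauss_ints. v $ i = e * f"
    unfolding forall_2 using gauss_ints_of_int by blast
  then obtain u where u: "u \<in> gauss_ints" "e * u = 1"
    using v(2) e unfolding primitive_vec_def by blast
  then have "u \<noteq> 0" by auto
  then have "cmod e * cmod u = 1" "1 \<le> cmod u"
    using u gauss_int_cmod_ge_1[of u] by (simp_all flip: norm_mult)
  then have "cmod e \<le> 1" by (metis mult_left_mono norm_ge_zero mult.right_neutral)
  then have "cmod e * \<bar>of_int q\<bar> \<le> 1 * \<bar>real_of_int q\<bar>" "cmod e * \<bar>of_int p\<bar> \<le> 1 * \<bar>real_of_int p\<bar>"
    by (intro mult_right_mono; simp)+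
  then have "max_abs v \<le> of_int (max \<bar>p\<bar> \<bar>q\<bar>)"
    by (auto simp: max_abs_def v12 norm_mult of_int_max)
  then show ?thesis using v(3) by simp
qed

section \<open>Groups with prescribed real eigenspaces\<close>

lemma invertible_mat_one: "invertible (mat 1 :: real^2^2)"
  unfolding invertible_def by (intro exI[of _ "mat 1"]) simp

lemma group_GL2: "group GL2"
proof (rule groupI)
  fix x assume "x \<in> carrier GL2"
  then obtain y where "x ** y = mat 1" "y ** x = mat 1" by (auto simp: GL2_def invertible_def)
  then have "y \<in> carrier GL2 \<and> y \<otimes>\<^bsub>GL2\<^esub> x = \<one>\<^bsub>GL2\<^esub>" by (auto simp: GL2_def invertible_def)
  then show "\<exists>y\<in>carrier GL2. y \<otimes>\<^bsub>GL2\<^esub> x = \<one>\<^bsub>GL2\<^esub>" by blast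
qed (auto simp: GL2_def invertible_mult matrix_mul_assoc intro: invertible_mat_one)

definition centralizer :: "real^2^2 \<Rightarrow> (real^2^2) set" where
  "centralizer R = {X. invertible X \<and> X ** R = R ** X}"

lemma matrix_mult_2: "(A ** B) $ i $ j = A $ i $ 1 * B $ 1 $ j + A $ i $ 2 * B $ 2 $ j"
  for A B :: "real^2^2"
  by (simp add: matrix_matrix_mult_def sum_2)

text \<open>
  A matrix commutes with a given one iff the vectors \<open>(x\<^sub>1\<^sub>2, x\<^sub>2\<^sub>1, x\<^sub>2\<^sub>2 - x\<^sub>1\<^sub>1)\<close> of the two matrices are
  parallel.  For \<open>R\<close> this vector is nonzero, so the vectors of \<open>X\<close> and \<open>Y\<close>, being multiples of it, are
  parallel to each other.
\<close>
lemma centralizer_commute: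
  assumes "R $ 1 $ 2 \<noteq> 0" "X \<in> centralizer R" "Y \<in> centralizer R"
  shows "X ** Y = Y ** X"
proof -
  have *: "Z$1$2 * R$2$1 = R$1$2 * Z$2$1" "Z$1$2 * (R$2$2 - R$1$1) = R$1$2 * (Z$2$2 - Z$1$1)"
    if "Z \<in> centralizer R" for Z
  proof -
    have "Z ** R = R ** Z" using that by (simp add: centralizer_def)
    then have "(Z ** R) $ i $ j = (R ** Z) $ i $ j" for i j by simp
    from this[of 1 1] this[of 1 2] show "Z$1$2 * R$2$1 = R$1$2 * Z$2$1" "Z$1$2 * (R$2$2 - R$1$1) = R$1$2 * (Z$2$2 - Z$1$1)"
      by (simp_all add: matrix_mult_2 algebra_simps)
  qed
  note X = *[OF assms(2)] and Y = *[OF assms(3)]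
  have "R$1$2 * (X$1$2 * Y$2$1 - Y$1$2 * X$2$1) = 0"
    using X(1) Y(1) by algebra
  then have 1: "X$1$2 * Y$2$1 = Y$1$2 * X$2$1" using assms(1) by simp
  have "R$1$2 * (X$1$2 * (Y$2$2 - Y$1$1) - Y$1$2 * (X$2$2 - X$1$1)) = 0"
    using X(2) Y(2) by algebra
  then have 2: "X$1$2 * (Y$2$2 - Y$1$1) = Y$1$2 * (X$2$2 - X$1$1)" using assms(1) by simp
  have "R$1$2 * R$1$2 * (X$2$1 * (Y$2$2 - Y$1$1) - Y$2$1 * (X$2$2 - X$1$1)) = 0"
    using X Y by algebra
  then have 3: "X$2$1 * (Y$2$2 - Y$1$1) = Y$2$1 * (X$2$2 - X$1$1)" using assms(1) by simp
  show ?thesis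
    unfolding vec_eq_iff forall_2 matrix_mult_2 using 1 2 3 by (simp add: algebra_simps)
qed

lemma comm_subgroup_centralizer:
  assumes "R $ 1 $ 2 \<noteq> 0"
  shows "comm_subgroup (centralizer R)"
proof -
  interpret G: group GL2 by (rule group_GL2)
  have sub: "subgroup (centralizer R) GL2"
  proof (rule G.subgroupI)
    show "centralizer R \<subseteq> carrier GL2" by (auto simp: centralizer_def GL2_def)
    show "centralizer R \<noteq> {}" using invertible_mat_one by (force simp: centralizer_def)
  next
    fix X assume X: "X \<in> centralizer R"
    let ?Y = "inv\<^bsub>GL2\<^esub> X"
    have XG: "X \<in> carrier GL2" using X by (auto simp: centralizer_def GL2_def)
    then have Y: "?Y ** X = mat 1" "X ** ?Y = mat 1" "invertible ?Y"
      using G.l_inv[OF XG] G.r_inv[OF XG] G.inv_closed[OF XG] by (simp_all add: GL2_def)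
    have "?Y ** R = ?Y ** (R ** X) ** ?Y"
      using Y(2) by (simp flip: matrix_mul_assoc)
    also have "\<dots> = ?Y ** (X ** R) ** ?Y" using X by (simp add: centralizer_def)
    also have "\<dots> = R ** ?Y" using Y(1) by (simp add: matrix_mul_assoc)
    finally show "?Y \<in> centralizer R" using Y by (simp add: centralizer_def)
  next
    fix X Y assume XY: "X \<in> centralizer R" "Y \<in> centralizer R"
    then have "X ** Y ** R = R ** (X ** Y)"
      by (metis (mono_tags, lifting) centralizer_def matrix_mul_assoc mem_Collect_eq)
    then show "X \<otimes>\<^bsub>GL2\<^esub> Y \<in> centralizer R"
      using XY by (simp add: centralizer_def GL2_def invertible_mult)
  qed
  have "group (GL2\<lparr>carrier := centralizer R\<rparr>)"
    using sub group_GL2 by (rule subgroup.subgroup_is_group)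
  then have "comm_group (GL2\<lparr>carrier := centralizer R\<rparr>)"
    by (rule group.group_comm_groupI) (auto simp: GL2_def centralizer_commute[OF assms])
  with sub show ?thesis by (simp add: comm_subgroup_def)
qed

text \<open>
  A commutative group containing the centralizer of \<open>R\<close> contains \<open>R\<close> itself, so all its elements
  commute with \<open>R\<close>.
\<close>
lemma mcrs_group_centralizer:
  assumes "R $ 1 $ 2 \<noteq> 0" "invertible R" "regular R"
  shows "mcrs_group (centralizer R)"
proof -
  have R: "R \<in> centralizer R" using assms(2) by (simp add: centralizer_def)
  have "K = centralizer R" if K: "comm_subgroup K" "centralizer R \<subseteq> K" for K
  proof
    have "K \<subseteq> carrier GL2" using K(1) by (simp add: comm_subgroup_def subgroup.subset)
    then show "K \<subseteq> centralizer R"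
      using comm_subgroup_commute[OF K(1)] R K(2) by (auto simp: centralizer_def GL2_def)
  qed (rule K)
  then show ?thesis
    unfolding mcrs_group_def using comm_subgroup_centralizer[OF assms(1)] R assms(3) by blast
qed

lemma slope_line_eq_spanned_line: "slope_line b = spanned_line (vector [1, of_real b])"
  by (auto simp: slope_line_def spanned_line_def mult.commute)

lemma ex_mcrs_group_slope_lines:
  assumes "b1 \<noteq> b2"
  obtains K where "mcrs_group K" "eigenspaces K = {slope_line b1, slope_line b2}"
proof -
  define d where "d = b2 - b1"
  have d: "d \<noteq> 0" and b2: "b2 = b1 + d" using assms by (auto simp: d_def)
  \<comment> \<open>The identity plus the projection onto \<open>y = b2 x\<close> along \<open>y = b1 x\<close>, with eigenvalues \<open>1\<close> and \<open>2\<close>.\<close>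
  define R :: "real^2^2" where
    "R = vector [vector [1 - b1 / d, 1 / d], vector [- (b1 * b2 / d), 1 + b2 / d]]"
  have ent: "R$1$1 = 1 - b1 / d" "R$1$2 = 1 / d" "R$2$1 = - (b1 * b2 / d)" "R$2$2 = 1 + b2 / d"
    by (simp_all add: R_def)
  let ?u1 = "vector [1, of_real b1] :: complex^2" and ?u2 = "vector [1, of_real b2] :: complex^2"
  have u: "?u1 \<noteq> 0" "?u2 \<noteq> 0" by (auto simp: vec_eq_iff forall_2)
  have dc: "complex_of_real d \<noteq> 0" using d by simp
  have e1: "?u1 \<in> eigenspace R 1"
    unfolding mem_eigenspace_iff ent using dc by (simp add: field_simps b2)
  have e2: "?u2 \<in> eigenspace R 2"
    unfolding mem_eigenspace_iff ent using dc by (simp add: field_simps b2)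
  have ev: "eigval R 1" "eigval R 2" using e1 e2 u by (auto simp: eigval_iff)
  then have reg: "regular R" unfolding regular_def by (intro exI[of _ 1] exI[of _ 2]) auto
  have "det R = 2" unfolding det_2 ent using d by (simp add: b2 field_simps)
  then have inv: "invertible R" by (simp add: invertible_det_nz)
  have mcrs: "mcrs_group (centralizer R)"
    using d by (intro mcrs_group_centralizer inv reg) (simp add: ent)
  have "R \<in> centralizer R" using inv by (simp add: centralizer_def)
  have "eigenspaces (centralizer R) = {eigenspace R 1, eigenspace R 2}"
    using \<open>R \<in> centralizer R\<close> ev d
    by (intro eigenspaces_commuting_set centralizer_commute[of R]) (auto simp: ent)
  also have "\<dots> = {slope_line b1, slope_line b2}"
    unfolding slope_line_eq_spanned_line eigenspace_eq_spanned_line[OF reg u(1) e1] eigenspace_eq_spanned_line[OF reg u(2) e2] ..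
  finally show thesis using mcrs that by blast
qed

lemma ex_rational_group:
  fixes p1 q1 p2 q2 :: int
  assumes "coprime p1 q1" "0 < q1" "\<bar>p1\<bar> \<le> int N" "q1 \<le> int N"
    and "coprime p2 q2" "0 < q2" "\<bar>p2\<bar> \<le> int N" "q2 \<le> int N"
    and "real_of_int p1 / of_int q1 \<noteq> of_int p2 / of_int q2"
  obtains K where "K \<in> Rat2" "size_mcrs K \<le> real N"
    "eigenspaces K = {slope_line (of_int p1 / of_int q1), slope_line (of_int p2 / of_int q2)}"
proof -
  obtain K where K: "mcrs_group K"
    "eigenspaces K = {slope_line (of_int p1 / of_int q1), slope_line (of_int p2 / of_int q2)}"
    using ex_mcrs_group_slope_lines[OF assms(9)] .
  have "\<exists>v\<in>slope_line (of_int p / of_int q). v \<noteq> 0 \<and> gauss_vec v" if "0 < q" for p q :: int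
    using that
    by (intro bexI[of _ "vector [of_int q, of_int p]"])
      (auto simp: slope_line_def gauss_vec_def forall_2 gauss_ints_of_int vec_eq_iff)
  then have "K \<in> Rat2"
    using K assms(2,6) by (auto simp: Rat2_def rational_group_def)
  moreover have "line_size (slope_line (of_int p / of_int q)) \<le> real N"
    if "coprime p q" "0 < q" "\<bar>p\<bar> \<le> int N" "q \<le> int N" for p q :: int
  proof -
    have "max \<bar>p\<bar> \<bar>q\<bar> \<le> int N" using that by simp
    then have "real_of_int (max \<bar>p\<bar> \<bar>q\<bar>) \<le> real N" by linarith
    then show ?thesis using line_size_slope_line_le[OF that(1,2)] by linarith
  qed
  then have "size_mcrs K \<le> real N"
    unfolding size_mcrs_def K(2) using assms by simp
  ultimately show thesis using that K(2) by blast
qed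

section \<open>Existence of best approximations\<close>

lemma finite_bounded_gauss_vecs: "finite {v. gauss_vec v \<and> max_abs v \<le> real N}"
proof -
  let ?I = "{- int N..int N}"
  let ?Z = "(\<lambda>(a, b). Complex (of_int a) (of_int b)) ` (?I \<times> ?I)"
  have "z \<in> ?Z" if z: "z \<in> gauss_ints" "cmod z \<le> real N" for z
  proof -
    obtain a b :: int where ab: "Re z = a" "Im z = b"
      using z(1) by (auto simp: gauss_ints_def elim!: Ints_cases)
    then have "\<bar>real_of_int a\<bar> \<le> real N" "\<bar>real_of_int b\<bar> \<le> real N"
      using abs_Re_le_cmod[of z] abs_Im_le_cmod[of z] z(2) by auto
    then have "a \<in> ?I" "b \<in> ?I" by auto
    moreover have "z = Complex (of_int a) (of_int b)" using ab by (simp add: complex_eq_iff)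
    ultimately show ?thesis by auto
  qed
  then have Z: "v $ 1 \<in> ?Z" "v $ 2 \<in> ?Z" if "gauss_vec v" "max_abs v \<le> real N" for v
    using that order_trans[OF max_abs_bounds(1) that(2)] order_trans[OF max_abs_bounds(2) that(2)]
    unfolding gauss_vec_def by blast+
  have "{v. gauss_vec v \<and> max_abs v \<le> real N} \<subseteq> (\<lambda>(x, y). vector [x, y]) ` (?Z \<times> ?Z)"
  proof
    fix v :: "complex^2" assume v: "v \<in> {v. gauss_vec v \<and> max_abs v \<le> real N}"
    have "v = vector [v $ 1, v $ 2]" by (simp add: vec_eq_iff forall_2)
    with v show "v \<in> (\<lambda>(x, y). vector [x, y]) ` (?Z \<times> ?Z)"
      by (intro image_eqI[of _ _ "(v $ 1, v $ 2)"]) (simp, use Z in blast)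
  qed
  moreover have "finite ((\<lambda>(x, y). vector [x, y] :: complex^2) ` (?Z \<times> ?Z))"
    by (intro finite_imageI finite_cartesian_product) auto
  ultimately show ?thesis by (rule finite_subset)
qed

text \<open>
  The eigenspaces of a rational group of size at most \<open>N\<close> are spanned by Gaussian vectors of length at
  most \<open>N\<close>, which are finite in number, and the discrepancy factors through the set of eigenspaces.
\<close>
lemma finite_discrepancy_image:
  "finite (discrepancy H ` {K. K \<in> Rat2 \<and> size_mcrs K \<le> real N})"
proof -
  let ?S = "{K. K \<in> Rat2 \<and> size_mcrs K \<le> real N}"
  let ?V = "{v. gauss_vec v \<and> max_abs v \<le> real N}"
  have "eigenspaces K \<subseteq> spanned_line ` ?V" if K: "K \<in> ?S" for K
  proof
    fix l assume l: "l \<in> eigenspaces K"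
    have rat: "rational_group K" and m: "mcrs_group K" using K by (auto simp: Rat2_def rational_group_def)
    obtain v where v: "v \<in> l" "primitive_vec v" "max_abs v = line_size l"
      using line_size_attained[OF rat l] .
    obtain u where u: "u \<noteq> 0" "l = spanned_line u"
      using mcrs_group_eigenspaces[OF m] l by (metis empty_iff insert_iff)
    then have "spanned_line v = l" using v primitive_vec_nonzero spanned_line_eqI by blast
    moreover have "v \<in> ?V"
      using v line_size_le_size_mcrs[OF m l] K by (auto simp: primitive_vec_def)
    ultimately show "l \<in> spanned_line ` ?V" by blast
  qed
  then have "eigenspaces ` ?S \<subseteq> Pow (spanned_line ` ?V)" by blast
  then have "finite (eigenspaces ` ?S)"
    using finite_bounded_gauss_vecs by (meson finite_Pow_iff finite_imageI finite_subset)
  moreover have "discrepancy H K = discrepancy H (SOME K'. eigenspaces K' = eigenspaces K)" for K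
  proof -
    have "eigenspaces (SOME K'. eigenspaces K' = eigenspaces K) = eigenspaces K"
      by (rule someI) (rule refl)
    then show ?thesis unfolding discrepancy_def by (metis md_form_cong)
  qed
  then have "discrepancy H ` ?S
      = (\<lambda>E. discrepancy H (SOME K'. eigenspaces K' = E)) ` eigenspaces ` ?S"
    unfolding image_image by (intro image_cong) auto
  ultimately show ?thesis by simp
qed

lemma ex_best_approx:
  assumes "K \<in> Rat2" "size_mcrs K \<le> real N"
  shows "\<exists>B. best_approx H N B"
proof -
  let ?D = "discrepancy H ` {K. K \<in> Rat2 \<and> size_mcrs K \<le> real N}"
  have "?D \<noteq> {}" using assms by blast
  then have "Min ?D \<in> ?D" by (intro Min_in finite_discrepancy_image)
  then obtain B where B: "B \<in> Rat2" "size_mcrs B \<le> real N" "discrepancy H B = Min ?D" by auto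
  have "discrepancy H B \<le> discrepancy H K'" if "K' \<in> Rat2" "size_mcrs K' \<le> real N" for K'
    unfolding B(3) using that by (intro Min_le finite_discrepancy_image) auto
  then have "best_approx H N B"
    unfolding best_approx_def is_arg_min_def using B(1,2) by (auto simp: not_less)
  then show ?thesis ..
qed

lemma best_approxD:
  assumes "best_approx H N B"
  shows "B \<in> Rat2" "size_mcrs B \<le> real N"
    "\<And>K. K \<in> Rat2 \<Longrightarrow> size_mcrs K \<le> real N \<Longrightarrow> discrepancy H B \<le> discrepancy H K"
  using assms unfolding best_approx_def is_arg_min_def by (auto simp: not_less)

lemma discrepancy_nonneg: "0 \<le> discrepancy H K"
  using max_coeff_nonneg by (simp add: discrepancy_def)

section \<open>The two bounds on the discrepancy\<close>

text \<open>
  Write \<open>X\<close> and \<open>Y\<close> for the moduli of the two linear factors.  The vector is recovered from the values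
  of the two factors, so its length is at most \<open>K * max X Y\<close>, while \<open>min X Y\<close> is at least a constant over
  its length; the length cancels from the product \<open>X * Y\<close>.
\<close>
lemma badly_approximable_form_lower_bound:
  assumes "badly_approximable a1" "badly_approximable a2" "a1 \<noteq> a2"
  obtains c where "c > 0" "\<And>v. gauss_vec v \<Longrightarrow> v \<noteq> 0 \<Longrightarrow> c \<le> cmod (quad_form (slope_form a1 a2) v)"
proof -
  obtain c1 where c1: "c1 > 0" "\<And>v. gauss_vec v \<Longrightarrow> v \<noteq> 0 \<Longrightarrow> c1 \<le> cmod (v $ 2 - of_real a1 * v $ 1) * max_abs v"
    by (rule badly_approximable_gauss[OF assms(1)]) blast
  obtain c2 where c2: "c2 > 0" "\<And>v. gauss_vec v \<Longrightarrow> v \<noteq> 0 \<Longrightarrow> c2 \<le> cmod (v $ 2 - of_real a2 * v $ 1) * max_abs v"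
    by (rule badly_approximable_gauss[OF assms(2)]) blast
  define \<delta> where "\<delta> = \<bar>a1 - a2\<bar>"
  have \<delta>: "\<delta> > 0" using assms(3) by (simp add: \<delta>_def)
  define K where "K = 1 + 2 * (1 + \<bar>a1\<bar>) / \<delta>"
  have K: "K > 0" unfolding K_def using \<delta> by (intro add_pos_nonneg divide_nonneg_pos) auto
  show thesis
  proof
    show "min c1 c2 / K / \<delta> > 0" using c1 c2 K \<delta> by simp
    fix v assume v: "gauss_vec v" "v \<noteq> 0"
    define X where "X = cmod (v $ 2 - of_real a1 * v $ 1)"
    define Y where "Y = cmod (v $ 2 - of_real a2 * v $ 1)"
    define m where "m = max X Y"
    have XY: "0 \<le> X" "0 \<le> Y" "X \<le> m" "Y \<le> m" by (auto simp: X_def Y_def m_def)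
    have "of_real (a1 - a2) * v $ 1 = (v $ 2 - of_real a2 * v $ 1) - (v $ 2 - of_real a1 * v $ 1)"
      by (simp add: algebra_simps)
    then have "\<delta> * cmod (v $ 1) \<le> Y + X"
      unfolding \<delta>_def X_def Y_def by (metis norm_mult norm_of_real norm_triangle_ineq4)
    then have "\<delta> * cmod (v $ 1) \<le> 2 * m" using XY by linarith
    then have v1: "cmod (v $ 1) \<le> 2 * m / \<delta>" using \<delta> by (simp add: field_simps)
    have "v $ 2 = (v $ 2 - of_real a1 * v $ 1) + of_real a1 * v $ 1" by simp
    then have "cmod (v $ 2) \<le> X + \<bar>a1\<bar> * cmod (v $ 1)"
      unfolding X_def by (metis norm_mult norm_of_real norm_triangle_ineq)
    also have "\<dots> \<le> m + \<bar>a1\<bar> * (2 * m / \<delta>)"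
      using XY v1 by (intro add_mono mult_left_mono) auto
    finally have v2: "cmod (v $ 2) \<le> m + \<bar>a1\<bar> * (2 * m / \<delta>)" .
    have Km: "K * m = m + 2 * m / \<delta> + \<bar>a1\<bar> * (2 * m / \<delta>)"
      unfolding K_def by (simp add: add_divide_distrib algebra_simps)
    have "0 \<le> 2 * m / \<delta>" "0 \<le> \<bar>a1\<bar> * (2 * m / \<delta>)" using XY \<delta> by auto
    then have vm: "max_abs v \<le> K * m" using v1 v2 XY unfolding max_abs_def Km by auto
    have "min c1 c2 \<le> min X Y * max_abs v"
      using c1(2)[OF v] c2(2)[OF v] by (auto simp: X_def Y_def min_def)
    also have "\<dots> \<le> min X Y * (K * m)" using vm XY by (intro mult_left_mono) auto
    also have "\<dots> = K * (X * Y)" by (auto simp: m_def min_def max_def)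
    finally have "min c1 c2 / K \<le> X * Y" using K by (simp add: divide_le_eq mult.commute)
    then have "min c1 c2 / K / \<delta> \<le> X * Y / \<delta>" using \<delta> by (intro divide_right_mono) auto
    also have "\<dots> = cmod (quad_form (slope_form a1 a2) v)"
      unfolding quad_form_slope_form X_def Y_def \<delta>_def norm_divide norm_mult norm_of_real ..
    finally show "min c1 c2 / K / \<delta> \<le> cmod (quad_form (slope_form a1 a2) v)" .
  qed
qed

lemma discrepancy_rational_lower_bound:
  assumes "badly_approximable a1" "badly_approximable a2" "a1 \<noteq> a2"
    and "mcrs_group H" "eigenspaces H = {slope_line a1, slope_line a2}"
  obtains c where "c > 0" "\<And>K N. K \<in> Rat2 \<Longrightarrow> size_mcrs K \<le> real N \<Longrightarrow> c \<le> discrepancy H K * (real N)\<^sup>2"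
proof -
  obtain c where c: "c > 0" "\<And>v. gauss_vec v \<Longrightarrow> v \<noteq> 0 \<Longrightarrow> c \<le> cmod (quad_form (slope_form a1 a2) v)"
    by (rule badly_approximable_form_lower_bound[OF assms(1-3)]) blast
  show thesis
  proof
    show "c / 3 > 0" using c by simp
    fix K and N :: nat assume K: "K \<in> Rat2" "size_mcrs K \<le> real N"
    then have rat: "rational_group K" and m: "mcrs_group K" by (auto simp: Rat2_def rational_group_def)
    obtain l where l: "l \<in> eigenspaces K" using mcrs_group_eigenspaces[OF m] by (metis insertI1)
    obtain v where v: "v \<in> l" "primitive_vec v" "max_abs v = line_size l"
      using line_size_attained[OF rat l] .
    have vN: "max_abs v \<le> real N" using v(3) line_size_le_size_mcrs[OF m l] K(2) by simp
    have "0 \<le> max_abs v" using max_abs_bounds(1)[of v] norm_ge_zero order_trans by blast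
    have "quad_form (- slope_form a1 a2) v = - quad_form (slope_form a1 a2) v"
      by (simp add: quad_form_def)
    then have "cmod (quad_form (md_form H) v) = cmod (quad_form (slope_form a1 a2) v)"
      using md_form_of_slope_lines[OF assms(4,5,3)] by auto
    then have "c \<le> cmod (quad_form (md_form H) v)"
      using c(2)[of v] v(2) primitive_vec_nonzero by (simp add: primitive_vec_def)
    also have "\<dots> \<le> 3 * discrepancy H K * (max_abs v)\<^sup>2"
      by (rule cmod_md_form_le_discrepancy[OF m l v(1)])
    also have "\<dots> \<le> 3 * discrepancy H K * (real N)\<^sup>2"
      using vN \<open>0 \<le> max_abs v\<close> discrepancy_nonneg by (intro mult_left_mono power_mono) auto
    finally show "c / 3 \<le> discrepancy H K * (real N)\<^sup>2" by simp
  qed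
qed

text \<open>
  For large \<open>N\<close> the group is built from two good rational slopes.  The finitely many small \<open>N\<close> are
  covered by the fixed group with eigenspaces \<open>y = 0\<close> and \<open>y = x\<close>, whose size is \<open>1\<close>, at the cost of
  enlarging the constant.
\<close>
lemma discrepancy_rational_upper_bound:
  assumes "badly_approximable a1" "badly_approximable a2" "a1 \<noteq> a2"
    and "mcrs_group H" "eigenspaces H = {slope_line a1, slope_line a2}"
  obtains C where "C > 0" "\<And>N. 1 \<le> N \<Longrightarrow>
      \<exists>K\<in>Rat2. size_mcrs K \<le> real N \<and> discrepancy H K \<le> C / (real N)\<^sup>2"
proof -
  obtain C1 N1 where 1: "C1 > 0" "\<And>N :: nat. N1 \<le> N \<Longrightarrow>
      \<exists>p q :: int. coprime p q \<and> 0 < q \<and> \<bar>p\<bar> \<le> int N \<and> q \<le> int N \<and>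
        \<bar>a1 - of_int p / of_int q\<bar> \<le> C1 / (real N)\<^sup>2"
    by (rule badly_approximable_quadratic_approx[OF assms(1)]) blast
  obtain C2 N2 where 2: "C2 > 0" "\<And>N :: nat. N2 \<le> N \<Longrightarrow>
      \<exists>p q :: int. coprime p q \<and> 0 < q \<and> \<bar>p\<bar> \<le> int N \<and> q \<le> int N \<and>
        \<bar>a2 - of_int p / of_int q\<bar> \<le> C2 / (real N)\<^sup>2"
    by (rule badly_approximable_quadratic_approx[OF assms(2)]) blast
  obtain \<eta> L where L: "\<eta> > 0" "L > 0"
    "\<And>b1 b2 t. \<bar>a1 - b1\<bar> \<le> t \<Longrightarrow> \<bar>a2 - b2\<bar> \<le> t \<Longrightarrow> t \<le> \<eta> \<Longrightarrow>
       b1 \<noteq> b2 \<and> max_coeff (slope_form a1 a2 - slope_form b1 b2) \<le> L * t"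
    by (rule slope_form_locally_lipschitz[OF assms(3)]) blast
  define C where "C = max C1 C2"
  define N0 where "N0 = max (max N1 N2) (nat \<lceil>C / \<eta>\<rceil> + 1)"
  obtain K0 where K0: "K0 \<in> Rat2" "size_mcrs K0 \<le> real 1"
    by (rule ex_rational_group[of 0 1 1 1 1]) auto
  define D where "D = discrepancy H K0 * (real N0)\<^sup>2"
  have D: "0 \<le> D" using discrepancy_nonneg by (simp add: D_def)
  show thesis
  proof
    show "L * C + D > 0" using L(2) 1(1) D by (simp add: C_def add_pos_nonneg less_max_iff_disj)
    fix N :: nat assume N: "1 \<le> N"
    show "\<exists>K\<in>Rat2. size_mcrs K \<le> real N \<and> discrepancy H K \<le> (L * C + D) / (real N)\<^sup>2"
    proof (cases "N0 \<le> N")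
      case True
      define t where "t = C / (real N)\<^sup>2"
      have "C / \<eta> \<le> real N" using True unfolding N0_def by linarith
      then have "C / real N \<le> \<eta>" using N L(1) by (simp add: field_simps)
      moreover have "t \<le> C / real N"
        unfolding t_def using N 1(1) by (intro divide_left_mono) (auto simp: power2_eq_square C_def)
      ultimately have t: "t \<le> \<eta>" by simp
      have "C1 / (real N)\<^sup>2 \<le> t" "C2 / (real N)\<^sup>2 \<le> t"
        by (auto simp: t_def C_def intro!: divide_right_mono)
      note le = order_trans[OF _ this(1)] order_trans[OF _ this(2)]
      have "N1 \<le> N" "N2 \<le> N" using True by (auto simp: N0_def)
      then obtain p1 q1 p2 q2 where
        pq1: "coprime p1 q1" "0 < q1" "\<bar>p1\<bar> \<le> int N" "q1 \<le> int N" "\<bar>a1 - of_int p1 / of_int q1\<bar> \<le> t" and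
        pq2: "coprime p2 q2" "0 < q2" "\<bar>p2\<bar> \<le> int N" "q2 \<le> int N" "\<bar>a2 - of_int p2 / of_int q2\<bar> \<le> t"
        using 1(2)[of N] 2(2)[of N] le by meson
      have near: "real_of_int p1 / of_int q1 \<noteq> of_int p2 / of_int q2"
        "max_coeff (slope_form a1 a2 - slope_form (of_int p1 / of_int q1) (of_int p2 / of_int q2)) \<le> L * t"
        using L(3)[OF pq1(5) pq2(5) t] by auto
      obtain K where K: "K \<in> Rat2" "size_mcrs K \<le> real N"
        "eigenspaces K = {slope_line (of_int p1 / of_int q1), slope_line (of_int p2 / of_int q2)}"
        by (rule ex_rational_group[OF pq1(1-4) pq2(1-4) near(1)])
      have "mcrs_group K" using K(1) by (simp add: Rat2_def rational_group_def)
      then have "discrepancy H K \<le> L * t"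
        using discrepancy_le_slope_form[OF assms(4,5,3) _ K(3) near(1)] near(2) by linarith
      also have "\<dots> \<le> (L * C + D) / (real N)\<^sup>2"
        using D by (simp add: t_def divide_right_mono)
      finally show ?thesis using K by blast
    next
      case False
      have "discrepancy H K0 * (real N)\<^sup>2 \<le> D"
        unfolding D_def using False discrepancy_nonneg by (intro mult_left_mono power_mono) auto
      moreover have "0 \<le> L * C" using L(2) 1(1) by (simp add: C_def le_max_iff_disj)
      ultimately have "discrepancy H K0 \<le> (L * C + D) / (real N)\<^sup>2"
        using N by (simp add: le_divide_eq)
      moreover have "size_mcrs K0 \<le> real N" using K0(2) N by simp
      ultimately show ?thesis using K0(1) by blast
    qed
  qed
qed

theorem theorem3p1:
  fixes \<alpha>1 \<alpha>2 :: real and \<A> :: "(real^2^2) set"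
  assumes "\<alpha>1 \<noteq> \<alpha>2"
    and "bounded_inf_cf \<alpha>1" and "bounded_inf_cf \<alpha>2"
    and "mcrs_group \<A>" and "eigenspaces \<A> = {slope_line \<alpha>1, slope_line \<alpha>2}"
  shows "\<exists>C1>0. \<exists>C2>0. \<forall>N::nat. N \<ge> 1 \<longrightarrow>
           (\<exists>B. best_approx \<A> N B) \<and>
           (\<forall>B. best_approx \<A> N B \<longrightarrow>
              C1 / (real N)^2 < discrepancy \<A> B \<and> discrepancy \<A> B < C2 / (real N)^2)"
proof -
  note bad = bounded_inf_cf_badly_approximable[OF assms(2)] bounded_inf_cf_badly_approximable[OF assms(3)]
  obtain c where c: "c > 0"
    "\<And>K N. K \<in> Rat2 \<Longrightarrow> size_mcrs K \<le> real N \<Longrightarrow> c \<le> discrepancy \<A> K * (real N)\<^sup>2"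
    by (rule discrepancy_rational_lower_bound[OF bad assms(1,4,5)]) blast
  obtain C where C: "C > 0" "\<And>N. 1 \<le> N \<Longrightarrow>
      \<exists>K\<in>Rat2. size_mcrs K \<le> real N \<and> discrepancy \<A> K \<le> C / (real N)\<^sup>2"
    by (rule discrepancy_rational_upper_bound[OF bad assms(1,4,5)]) blast
  have main: "(\<exists>B. best_approx \<A> N B) \<and> (\<forall>B. best_approx \<A> N B \<longrightarrow>
      c / 2 / (real N)^2 < discrepancy \<A> B \<and> discrepancy \<A> B < (C + 1) / (real N)^2)"
    if N: "1 \<le> N" for N
  proof (intro conjI allI impI)
    obtain K where K: "K \<in> Rat2" "size_mcrs K \<le> real N" "discrepancy \<A> K \<le> C / (real N)\<^sup>2"
      using C(2)[OF N] by blast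
    show "\<exists>B. best_approx \<A> N B" using K(1,2) by (rule ex_best_approx)
    have N0: "0 < (real N)\<^sup>2" using N by simp
    fix B assume B: "best_approx \<A> N B"
    have "c / 2 < discrepancy \<A> B * (real N)\<^sup>2" using c(2)[OF best_approxD(1,2)[OF B]] c(1) by linarith
    then show "c / 2 / (real N)^2 < discrepancy \<A> B" using N0 by (simp add: divide_less_eq)
    have "discrepancy \<A> B \<le> C / (real N)\<^sup>2" using best_approxD(3)[OF B K(1,2)] K(3) by linarith
    also have "\<dots> < (C + 1) / (real N)\<^sup>2" using N0 by (intro divide_strict_right_mono) auto
    finally show "discrepancy \<A> B < (C + 1) / (real N)^2" .
  qed
  show ?thesis
    using c(1) C(1) main by (intro exI[of _ "c / 2"] exI[of _ "C + 1"] conjI) auto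
qed

end
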